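(* Let $q$ be a power of an odd prime, let $U=UU_n(\mathbb F_{q^2})$, and let $\eta$ and $\nu$ be twisted $\mathbb F_q$-set partitions of $[n]$. If for every arc $i\frown j\in\eta$ and every $k$ with $i<k<j$ neither $i\frown k$ nor $k\frown j$ is an arc of $\nu$ (with any label), then $$\chi^\eta(u_\nu)=\frac{\chi^\eta(1)}{(-q)^{\mathrm{nst}^\eta_\nu}}\;\theta\Bigg(\sum_{\substack{i\overset{a}{\frown}j\in\eta\\ i\overset{b}{\frown}j\in\nu}}ab\Bigg);$$ otherwise $\chi^\eta(u_\nu)=0$. Here $\mathrm{nst}^\eta_\nu=|\{i<j<k<l\mid j\frown k\in\nu,\ i\frown l\in\eta\}|$.
   Context: $G=UT_n(\mathbb F_{q^2})$ (unipotent upper triangular matrices), $\mathfrak g=\mathfrak{ut}_n(\mathbb F_{q^2})$ (strictly upper triangular matrices, viewed as an $\mathbb F_q$-algebra), $\bar i=n+1-i$. For $x\in\mathfrak g$ let $\overline x$ be the matrix with entries $(x_{ij})^q$, $J$ the matrix with ones on the antidiagonal and zeroes elsewhere, $x^\dagger=J\overline x^tJ$, and $(1+x)^\dagger=1+x^\dagger$. $U=UU_n(\mathbb F_{q^2})=\{g\in G\mid g^{-1}=g^\dagger\}$, $\mathfrak u=\{x\in\mathfrak g\mid x^\dagger=-x\}$, and $\mathfrak u^*$ is its $\mathbb F_q$-dual. $G$ acts on $\mathfrak u$ by $g\cdot x=gxg^\dagger$ and on $\mathfrak u^*$ by $(g\cdot\lambda)(x)=\lambda(g^{-1}\cdot x)$.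 Let $H=1+\mathfrak h$ with $\mathfrak h=\{x\in\mathfrak g\mid x_{ij}=0\text{ if }j\le n/2\}$. Fix a Springer morphism $f:G\to\mathfrak g$, i.e. a bijection with $f(U)=\mathfrak u$ and $f(1+x)=x+\sum_{i\ge2}a_ix^i$ for some $a_i\in\mathbb F_q$, and a nontrivial homomorphism $\theta:\mathbb F_q^+\to\mathbb C^\times$. For $\lambda\in\mathfrak u^*$ define the character of $U$ $$\chi_\lambda=\frac{|H\cdot\lambda|}{|G\cdot\lambda|}\sum_{\mu\in G\cdot\lambda}\theta\circ\mu\circ f .$$ An $\mathbb F_{q^2}$-set partition of $[n]$ is a set of labeled arcs $i\overset{a}{\frown}j$ with $1\le i<j\le n$, $a\in\mathbb F_{q^2}^\times$, such that each $i$ is the left endpoint of at most one arc and each $j$ is the right endpoint of at most one arc. A twisted $\mathbb F_q$-set partition is an $\mathbb F_{q^2}$-set partition $\eta$ of $[n]$ such that $i\overset{a}{\frown}j\in\eta$ implies $\bar j\overset{-a^q}{\frown}\bar i\in\eta$. Writing $i\frown j\in\eta$ means that $i\overset{a}{\frown}j\in\eta$ for some label $a$. For twisted $\eta$: $x_\eta\in\mathfrak u$ has $(i,j)$ entry $a$ if $i\overset{a}{\frown}j\in\eta$ and $0$ otherwise; $u_\eta\in U$ is the element with $f(u_\eta)=x_\eta$; $\lambda_\eta\in\mathfrak u^*$ is $\lambda_\eta(x)=\sum_{i\overset{a}{\frown}j\in\eta}ax_{ij}$ (which lies in $\mathbb F_q$ for $x\in\mathfrak u$); and $\chi^\eta=\chi_{\lambda_\eta}$.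 The sum of the terms $ab$ in the formula lies in $\mathbb F_q$, so $\theta$ may be applied to it. *)

theory Defs
  imports Complex_Main "HOL-Computational_Algebra.Primes" "HOL-Algebra.Group_Action"
    "Jordan_Normal_Form.Matrix"
begin

text \<open>
  Conventions. The field with $q^2$ elements is a type \<open>'a\<close> with \<open>card (UNIV :: 'a set) = q\<^sup>2\<close>.
  Indices are zero-based, as in the matrix library: the set $[n]$ is \<open>{0..<n}\<close>, so the index
  written $i$ on paper is \<open>i - 1\<close> here and $\bar i = n + 1 - i$ becomes \<open>n - 1 - i\<close>.
\<close>

definition base_field :: "nat \<Rightarrow> 'a::field set" where
  "base_field q = {a. a ^ q = a}"

definition bar :: "nat \<Rightarrow> nat \<Rightarrow> nat" where
  "bar n i = n - 1 - i"

definition ut :: "nat \<Rightarrow> 'a::field mat set" where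
  "ut n = {x \<in> carrier_mat n n. \<forall>i<n. \<forall>j<n. j \<le> i \<longrightarrow> x $$ (i, j) = 0}"

definition UT :: "nat \<Rightarrow> 'a::field mat monoid" where
  "UT n = \<lparr>carrier = {g \<in> carrier_mat n n. \<forall>i<n. \<forall>j<n.
                        (j < i \<longrightarrow> g $$ (i, j) = 0) \<and> (j = i \<longrightarrow> g $$ (i, j) = 1)},
           monoid.mult = (*), one = 1\<^sub>m n\<rparr>"

definition antidiag :: "nat \<Rightarrow> 'a::field mat" where
  "antidiag n = mat n n (\<lambda>(i, j). if j = bar n i then 1 else 0)"

text \<open>Since \<open>dagger\<close> is additive and fixes the identity, this one definition covers both
  $x^\dagger$ on the algebra and $(1 + x)^\dagger = 1 + x^\dagger$ on the group.\<close>

definition dagger :: "nat \<Rightarrow> nat \<Rightarrow> 'a::field mat \<Rightarrow> 'a mat" where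
  "dagger n q x = antidiag n * transpose_mat (map_mat (\<lambda>a. a ^ q) x) * antidiag n"

definition UU :: "nat \<Rightarrow> nat \<Rightarrow> 'a::field mat set" where
  "UU n q = {g \<in> carrier (UT n). inv\<^bsub>UT n\<^esub> g = dagger n q g}"

definition uu :: "nat \<Rightarrow> nat \<Rightarrow> 'a::field mat set" where
  "uu n q = {x \<in> ut n. dagger n q x = - x}"

text \<open>The condition $j \le n/2$ for a one-based column index $j$ reads
  \<open>2 * (j + 1) \<le> n\<close> for a zero-based one.\<close>

definition hh :: "nat \<Rightarrow> 'a::field mat set" where
  "hh n = {x \<in> ut n. \<forall>i<n. \<forall>j<n. 2 * (j + 1) \<le> n \<longrightarrow> x $$ (i, j) = 0}"

definition HH :: "nat \<Rightarrow> 'a::field mat monoid" where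
  "HH n = (UT n)\<lparr>carrier := (\<lambda>x. 1\<^sub>m n + x) ` hh n\<rparr>"

definition act :: "nat \<Rightarrow> nat \<Rightarrow> 'a::field mat \<Rightarrow> 'a mat \<Rightarrow> 'a mat" where
  "act n q g x = g * x * dagger n q g"

text \<open>Functionals in the dual of \<open>uu n q\<close> are represented by functions that are
  \<open>undefined\<close> outside \<open>uu n q\<close>, so that equality of functionals is equality of functions and
  orbits have the right cardinality.\<close>

definition coact :: "nat \<Rightarrow> nat \<Rightarrow> 'a::field mat \<Rightarrow> ('a mat \<Rightarrow> 'a) \<Rightarrow> ('a mat \<Rightarrow> 'a)" where
  "coact n q g l = restrict (\<lambda>x. l (act n q (inv\<^bsub>UT n\<^esub> g) x)) (uu n q)"

text \<open>The power series of a Springer morphism is written entrywise and cut off at \<open>n\<close>: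
  elements of \<open>ut n\<close> satisfy $x^n = 0$.\<close>

definition springer :: "nat \<Rightarrow> nat \<Rightarrow> ('a::field mat \<Rightarrow> 'a mat) \<Rightarrow> bool" where
  "springer n q f \<longleftrightarrow>
     bij_betw f (carrier (UT n)) (ut n) \<and> f ` UU n q = uu n q \<and>
     (\<exists>a :: nat \<Rightarrow> 'a. (\<forall>k. a k \<in> base_field q) \<and>
        (\<forall>x \<in> ut n. f (1\<^sub>m n + x) =
           x + mat n n (\<lambda>(i, j). \<Sum>k = 2..n. a k * (x ^\<^sub>m k) $$ (i, j))))"

text \<open>Only the values of \<open>\<theta>\<close> on \<open>base_field q\<close> matter.\<close>

definition nontrivial_char :: "nat \<Rightarrow> ('a::field \<Rightarrow> complex) \<Rightarrow> bool" where
  "nontrivial_char q \<theta> \<longleftrightarrow>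
     (\<forall>x \<in> base_field q. \<theta> x \<noteq> 0) \<and>
     (\<forall>x \<in> base_field q. \<forall>y \<in> base_field q. \<theta> (x + y) = \<theta> x * \<theta> y) \<and>
     (\<exists>x \<in> base_field q. \<theta> x \<noteq> 1)"

definition chi ::
  "nat \<Rightarrow> nat \<Rightarrow> ('a::field mat \<Rightarrow> 'a mat) \<Rightarrow> ('a \<Rightarrow> complex) \<Rightarrow> ('a mat \<Rightarrow> 'a) \<Rightarrow> 'a mat \<Rightarrow> complex"
where
  "chi n q f \<theta> l u =
     of_nat (card (orbit (HH n) (coact n q) l)) / of_nat (card (orbit (UT n) (coact n q) l)) *
     (\<Sum>\<mu> \<in> orbit (UT n) (coact n q) l. \<theta> (\<mu> (f u)))"

text \<open>The triple \<open>(i, a, j)\<close> is the arc from \<open>i\<close> to \<open>j\<close> with label \<open>a\<close>.\<close>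

definition set_partition :: "nat \<Rightarrow> (nat \<times> 'a::field \<times> nat) set \<Rightarrow> bool" where
  "set_partition n \<eta> \<longleftrightarrow>
     (\<forall>(i, a, j) \<in> \<eta>. i < j \<and> j < n \<and> a \<noteq> 0) \<and>
     (\<forall>(i, a, j) \<in> \<eta>. \<forall>(k, b, l) \<in> \<eta>. i = k \<or> j = l \<longrightarrow> (i, a, j) = (k, b, l))"

definition twisted_set_partition :: "nat \<Rightarrow> nat \<Rightarrow> (nat \<times> 'a::field \<times> nat) set \<Rightarrow> bool" where
  "twisted_set_partition n q \<eta> \<longleftrightarrow>
     set_partition n \<eta> \<and> (\<forall>(i, a, j) \<in> \<eta>. (bar n j, - (a ^ q), bar n i) \<in> \<eta>)"

definition arc :: "(nat \<times> 'a \<times> nat) set \<Rightarrow> nat \<Rightarrow> nat \<Rightarrow> bool" where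
  "arc \<eta> i j \<longleftrightarrow> (\<exists>a. (i, a, j) \<in> \<eta>)"

definition x_of :: "nat \<Rightarrow> (nat \<times> 'a::field \<times> nat) set \<Rightarrow> 'a mat" where
  "x_of n \<eta> = mat n n (\<lambda>(i, j). if arc \<eta> i j then THE a. (i, a, j) \<in> \<eta> else 0)"

definition u_of ::
  "nat \<Rightarrow> nat \<Rightarrow> ('a::field mat \<Rightarrow> 'a mat) \<Rightarrow> (nat \<times> 'a \<times> nat) set \<Rightarrow> 'a mat" where
  "u_of n q f \<eta> = the_inv_into (UU n q) f (x_of n \<eta>)"

definition lambda_of :: "nat \<Rightarrow> nat \<Rightarrow> (nat \<times> 'a::field \<times> nat) set \<Rightarrow> 'a mat \<Rightarrow> 'a" where
  "lambda_of n q \<eta> = restrict (\<lambda>x. \<Sum>(i, a, j) \<in> \<eta>. a * x $$ (i, j)) (uu n q)"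

definition chi_part ::
  "nat \<Rightarrow> nat \<Rightarrow> ('a::field mat \<Rightarrow> 'a mat) \<Rightarrow> ('a \<Rightarrow> complex) \<Rightarrow> (nat \<times> 'a \<times> nat) set \<Rightarrow> 'a mat \<Rightarrow> complex"
where
  "chi_part n q f \<theta> \<eta> = chi n q f \<theta> (lambda_of n q \<eta>)"

definition nst :: "(nat \<times> 'a \<times> nat) set \<Rightarrow> (nat \<times> 'a \<times> nat) set \<Rightarrow> nat" where
  "nst \<eta> \<nu> = card {(i, j, k, l). i < j \<and> j < k \<and> k < l \<and> arc \<nu> j k \<and> arc \<eta> i l}"

end

theory Submission
  imports Defs "HOL-Number_Theory.Residues" "Jordan_Normal_Form.Determinant"
begin

text \<open>
  By orbit counting, $\chi^\eta(u_\nu)/\chi^\eta(1)$ is the average of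
  $\theta(\lambda_\eta(g x_\nu g^\dagger))$ over $g \in G$. The argument of $\theta$ is the sum of
  $a b\, g_{ik}\, g_{\bar j \bar l}^q$ over the pairs of arcs $i \frown j \in \eta$ (label $a$) and
  $k \frown l \in \nu$ (label $b$) with $i \le k$ and $l \le j$. The position $(i,k)$ determines the pair,
  and duality of arcs is an involution on these pairs which carries $(i,k)$ to $(\bar j, \bar l)$.
  Hence the average factors over the orbits of this involution. When $i < k$ and $l < j$, an orbit of
  size two contributes the average $q^{-2}$ of $\theta(\mathrm{Tr}(c y z^q))$ and a fixed pair the
  average $-q^{-1}$ of $\theta(c y^{q+1})$. When exactly one of $i = k$, $l = j$ holds, the factor is
  the average of $\theta(\mathrm{Tr}(c y))$, which vanishes.
\<close>

section \<open>Character sums over the quadratic extension\<close>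

text \<open>The prime power shape of \<open>q\<close> enters as additivity of the
  \<open>q\<close>-th power, which the final theorem derives from the characteristic.\<close>

locale quadratic_char =
  fixes q :: nat and \<theta> :: "'a::{field, finite} \<Rightarrow> complex"
  assumes q_gt_1: "q > 1"
    and card_UNIV_eq: "card (UNIV :: 'a set) = q ^ 2"
    and add_power_q: "(x + y) ^ q = x ^ q + (y :: 'a) ^ q"
    and nontrivial: "nontrivial_char q \<theta>"
begin

text \<open>Multiplication by a nonzero \<open>x\<close> permutes the nonzero elements; comparing
  their products gives \<open>x ^ (q ^ 2 - 1) = 1\<close>. So the \<open>q\<close>-th power is the
  conjugation of the quadratic extension.\<close>

lemma power_q_power_q [simp]: "((x :: 'a) ^ q) ^ q = x"
proof (cases "x = 0")
  case False
  let ?N = "\<Prod>y\<in>UNIV - {0}. y :: 'a"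
  have "?N = (\<Prod>y\<in>UNIV - {0}. x * y)"
    using False by (intro prod.reindex_bij_witness[of _ "\<lambda>y. x * y" "\<lambda>y. y / x"]) auto
  also have "\<dots> = x ^ (q ^ 2 - 1) * ?N"
    by (simp add: prod.distrib card_Diff_singleton card_UNIV_eq)
  finally have "x ^ (q ^ 2 - 1) = 1"
    by simp
  then have "x ^ Suc (q ^ 2 - 1) = x"
    by simp
  moreover have "Suc (q ^ 2 - 1) = q * q"
    using q_gt_1 by (simp add: power2_eq_square)
  ultimately have "x ^ (q * q) = x"
    by metis
  then show ?thesis
    by (simp only: power_mult)
qed (use q_gt_1 in simp)

lemma zero_power_q [simp]: "(0 :: 'a) ^ q = 0"
  using q_gt_1 by simp

lemma uminus_power_q: "(- x :: 'a) ^ q = - (x ^ q)"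
  using add_power_q[of x "- x"] by (simp add: add_eq_0_iff)

lemma sum_power_q: "(\<Sum>x\<in>A. f x :: 'a) ^ q = (\<Sum>x\<in>A. f x ^ q)"
  by (induction A rule: infinite_finite_induct) (auto simp: add_power_q)

section \<open>Arithmetic of the base field, trace and norm\<close>

lemma base_field_0 [simp]: "(0 :: 'a) \<in> base_field q"
  by (simp add: base_field_def)

lemma base_field_add: "x \<in> base_field q \<Longrightarrow> y \<in> base_field q \<Longrightarrow> (x + y :: 'a) \<in> base_field q"
  by (simp add: base_field_def add_power_q)

lemma base_field_diff: "x \<in> base_field q \<Longrightarrow> y \<in> base_field q \<Longrightarrow> (x - y :: 'a) \<in> base_field q"
  using add_power_q[of x "- y"] by (simp add: base_field_def uminus_power_q)

lemma base_field_mult: "x \<in> base_field q \<Longrightarrow> y \<in> base_field q \<Longrightarrow> (x * y :: 'a) \<in> base_field q"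
  by (simp add: base_field_def power_mult_distrib)

lemma base_field_divide: "x \<in> base_field q \<Longrightarrow> y \<in> base_field q \<Longrightarrow> (x / y :: 'a) \<in> base_field q"
  by (simp add: base_field_def power_divide)

lemma trace_in_base_field: "(x :: 'a) + x ^ q \<in> base_field q"
  by (simp add: base_field_def add_power_q add.commute)

lemma norm_in_base_field: "(x :: 'a) * x ^ q \<in> base_field q"
  by (simp add: base_field_def power_mult_distrib mult.commute)

lemma theta_add:
  "x \<in> base_field q \<Longrightarrow> y \<in> base_field q \<Longrightarrow> \<theta> (x + y) = \<theta> x * \<theta> y"
  using nontrivial by (auto simp: nontrivial_char_def)

lemma theta_0 [simp]: "\<theta> 0 = 1"
  using nontrivial theta_add[of 0 0] by (auto simp: nontrivial_char_def)

text \<open>The base field is the root set of \<open>X ^ q - X\<close>. The count of norm fibres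
  calls for this upper bound.\<close>

lemma card_base_field_le: "card (base_field q :: 'a set) \<le> q"
proof -
  let ?P = "monom 1 q - monom 1 1 :: 'a poly"
  have "coeff ?P q = 1"
    using q_gt_1 by simp
  then have "?P \<noteq> 0"
    by (metis coeff_0 zero_neq_one)
  then have "card {x. poly ?P x = 0} \<le> degree ?P"
    by (rule card_poly_roots_bound)
  also have "degree ?P \<le> q"
    using q_gt_1 by (intro degree_diff_le) (auto simp: degree_monom_eq)
  also have "{x. poly ?P x = 0} = base_field q"
    by (auto simp: base_field_def poly_monom)
  finally show ?thesis .
qed

text \<open>Otherwise \<open>X ^ q + X\<close> would vanish at all \<open>q ^ 2\<close> elements,
  which exceeds its degree.\<close>

lemma ex_trace_nonzero: "\<exists>x :: 'a. x + x ^ q \<noteq> 0"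
proof (rule ccontr)
  assume neg: "\<not> ?thesis"
  let ?P = "monom 1 q + monom 1 1 :: 'a poly"
  have "coeff ?P q = 1"
    using q_gt_1 by simp
  then have "?P \<noteq> 0"
    by (metis coeff_0 zero_neq_one)
  then have "card {x. poly ?P x = 0} \<le> degree ?P"
    by (rule card_poly_roots_bound)
  also have "degree ?P \<le> q"
    using q_gt_1 by (intro degree_add_le) (auto simp: degree_monom_eq)
  also have "{x. poly ?P x = 0} = UNIV"
    using neg by (auto simp: poly_monom add.commute)
  finally show False
    using q_gt_1 by (simp add: card_UNIV_eq power2_eq_square)
qed

section \<open>Sums of the character over the base field, traces and norms\<close>

lemma sum_theta_base_field:
  assumes "c \<in> base_field q" "c \<noteq> 0"
  shows "(\<Sum>t\<in>base_field q. \<theta> (c * t)) = 0"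
proof -
  obtain z where z: "z \<in> base_field q" "\<theta> z \<noteq> 1"
    using nontrivial by (auto simp: nontrivial_char_def)
  \<comment> \<open>Translation by \<open>z / c\<close> permutes the base field and multiplies the
    sum by \<open>\<theta> z \<noteq> 1\<close>, so the sum is zero.\<close>
  have "(\<Sum>t\<in>base_field q. \<theta> (c * t)) = (\<Sum>t\<in>base_field q. \<theta> (c * (t + z / c)))"
    using z assms
    by (intro sum.reindex_bij_witness[of _ "\<lambda>t. t + z / c" "\<lambda>t. t - z / c"])
      (auto intro!: base_field_add base_field_diff base_field_divide)
  also have "\<dots> = (\<Sum>t\<in>base_field q. \<theta> (c * t)) * \<theta> z"
    using z assms unfolding sum_distrib_right
    by (intro sum.cong refl) (simp add: distrib_left theta_add base_field_mult)
  finally show ?thesis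
    using z by simp
qed

text \<open>Translating \<open>y\<close> by \<open>z / c\<close>, where the trace \<open>s\<close>
  of \<open>z\<close> satisfies \<open>\<theta> s \<noteq> 1\<close>, multiplies the sum by
  \<open>\<theta> s\<close>.\<close>

lemma sum_theta_trace:
  assumes "c \<noteq> 0"
  shows "(\<Sum>y\<in>UNIV. \<theta> (c * y + (c * y) ^ q)) = 0"
proof -
  obtain s where s: "s \<in> base_field q" "\<theta> s \<noteq> 1"
    using nontrivial by (auto simp: nontrivial_char_def)
  obtain x :: 'a where x: "x + x ^ q \<noteq> 0"
    using ex_trace_nonzero by blast
  \<comment> \<open>The trace is linear over the base field, so scaling \<open>x\<close> by
    \<open>r\<close> gives an element with the prescribed trace \<open>s\<close>.\<close>
  define r where "r = s / (x + x ^ q)"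
  define z where "z = r * x"
  have "r \<in> base_field q"
    unfolding r_def using s trace_in_base_field by (intro base_field_divide)
  then have "z + z ^ q = r * (x + x ^ q)"
    by (simp add: z_def power_mult_distrib distrib_left base_field_def)
  then have z: "z + z ^ q = s"
    using x by (simp add: r_def)
  have "(\<Sum>y\<in>UNIV. \<theta> (c * y + (c * y) ^ q))
      = (\<Sum>y\<in>UNIV. \<theta> (c * (y + z / c) + (c * (y + z / c)) ^ q))"
    by (intro sum.reindex_bij_witness[of _ "\<lambda>t. t + z / c" "\<lambda>t. t - z / c"]) auto
  also have "\<dots> = (\<Sum>y\<in>UNIV. \<theta> ((c * y + (c * y) ^ q) + s))"
    using assms by (intro sum.cong refl arg_cong[of _ _ \<theta>])
      (simp add: distrib_left add_power_q flip: z)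
  also have "\<dots> = (\<Sum>y\<in>UNIV. \<theta> (c * y + (c * y) ^ q)) * \<theta> s"
    unfolding sum_distrib_right using s by (simp add: theta_add trace_in_base_field)
  finally show ?thesis
    using s by simp
qed

text \<open>With \<open>y\<close> summed first, the inner sum is a trace sum; it vanishes unless
  \<open>z = 0\<close>, where all its \<open>q ^ 2\<close> terms are 1.\<close>

lemma sum_theta_hermitian_plane:
  assumes "c \<noteq> 0"
  shows "(\<Sum>y\<in>UNIV. \<Sum>z\<in>UNIV. \<theta> (c * y * z ^ q + (c * y * z ^ q) ^ q)) = of_nat q ^ 2"
proof -
  have "(\<Sum>y\<in>UNIV. \<Sum>z\<in>UNIV. \<theta> (c * y * z ^ q + (c * y * z ^ q) ^ q))
      = (\<Sum>z\<in>UNIV. \<Sum>y\<in>UNIV. \<theta> ((c * z ^ q) * y + ((c * z ^ q) * y) ^ q))"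
    by (subst sum.swap) (simp add: mult_ac)
  also have "\<dots> = (\<Sum>z\<in>UNIV. if z = (0 :: 'a) then of_nat q ^ 2 else 0)"
  proof (intro sum.cong refl)
    fix z :: 'a
    show "(\<Sum>y\<in>UNIV. \<theta> ((c * z ^ q) * y + ((c * z ^ q) * y) ^ q))
        = (if z = 0 then of_nat q ^ 2 else 0)"
      using sum_theta_trace[of "c * z ^ q"] assms by (auto simp: card_UNIV_eq)
  qed
  finally show ?thesis
    by simp
qed

text \<open>A fibre of the norm over a nonzero element has at most $q + 1$ points; since the
  $q^2 - 1$ units are spread over at most $q - 1$ fibres, all these bounds are attained.\<close>

lemma card_norm_fibre:
  assumes "t \<in> base_field q" "t \<noteq> 0"
  shows "card {y :: 'a. y * y ^ q = t} = q + 1"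
proof (rule ccontr)
  assume neq: "card {y. y * y ^ q = t} \<noteq> q + 1"
  define B where "B = base_field q - {0 :: 'a}"
  have fin: "finite B"
    by simp
  have le: "card {y. y * y ^ q = s} \<le> q + 1" for s :: 'a
  proof -
    let ?P = "monom 1 (Suc q) - [:s:]"
    have "coeff ?P (Suc q) = 1"
      by simp
    then have "?P \<noteq> 0"
      by (metis coeff_0 zero_neq_one)
    then have "card {x. poly ?P x = 0} \<le> degree ?P"
      by (rule card_poly_roots_bound)
    also have "degree ?P \<le> q + 1"
      by (intro degree_diff_le) (auto simp: degree_monom_eq)
    also have "{x. poly ?P x = 0} = {y. y * y ^ q = s}"
      by (auto simp: poly_monom)
    finally show ?thesis .
  qed
  have "q ^ 2 - 1 = card (UNIV - {0 :: 'a})"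
    by (subst card_Diff_singleton) (auto simp: card_UNIV_eq)
  also have "\<dots> = (\<Sum>y\<in>UNIV - {0 :: 'a}. 1)"
    by simp
  also have "\<dots> = (\<Sum>s\<in>B. \<Sum>y\<in>{y \<in> UNIV - {0}. y * y ^ q = s}. 1)"
    by (intro sum.group[symmetric]) (auto simp: B_def intro: norm_in_base_field)
  also have "\<dots> = (\<Sum>s\<in>B. card {y. y * y ^ q = s})"
    by (intro sum.cong refl) (auto simp: B_def intro!: arg_cong[of _ _ card])
  also have "\<dots> < (\<Sum>s\<in>B. q + 1)"
    using assms neq le[of t] fin by (intro sum_strict_mono_ex1 ballI le bexI[of _ t]) (auto simp: B_def)
  also have "\<dots> = card B * (q + 1)"
    by simp
  also have "\<dots> \<le> (q - 1) * (q + 1)"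
    using card_base_field_le by (intro mult_right_mono) (auto simp: B_def)
  also have "\<dots> = q ^ 2 - 1"
    by (simp add: algebra_simps power2_eq_square)
  finally show False
    by simp
qed

text \<open>Grouping by the norm \<open>t\<close>, the value \<open>t = 0\<close> contributes 1 and
  every other \<open>t\<close> is taken \<open>q + 1\<close> times. As
  \<open>\<theta> (c * t)\<close> sums to -1 over \<open>t \<noteq> 0\<close>, the total is
  \<open>1 - (q + 1)\<close>. This is the source of the sign in the powers of
  \<open>- q\<close>.\<close>

lemma sum_theta_norm:
  assumes "c \<in> base_field q" "c \<noteq> 0"
  shows "(\<Sum>y\<in>UNIV. \<theta> (c * y * y ^ q)) = - of_nat q"
proof -
  have fib: "(\<Sum>y\<in>{y. y * y ^ q = t}. \<theta> (c * y * y ^ q)) = of_nat (q + 1) * \<theta> (c * t)"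
    if "t \<in> base_field q - {0}" for t
  proof -
    have "(\<Sum>y\<in>{y. y * y ^ q = t}. \<theta> (c * y * y ^ q)) = (\<Sum>y\<in>{y. y * y ^ q = t}. \<theta> (c * t))"
      by (intro sum.cong refl) (auto simp: mult.assoc)
    also have "\<dots> = of_nat (q + 1) * \<theta> (c * t)"
      using card_norm_fibre[of t] that by simp
    finally show ?thesis .
  qed
  have "(\<Sum>y\<in>UNIV. \<theta> (c * y * y ^ q))
      = (\<Sum>t\<in>base_field q. \<Sum>y\<in>{y \<in> UNIV. y * y ^ q = t}. \<theta> (c * y * y ^ q))"
    by (intro sum.group[symmetric]) (auto intro: norm_in_base_field)
  also have "\<dots> = 1 + (\<Sum>t\<in>base_field q - {0}. \<Sum>y\<in>{y. y * y ^ q = t}. \<theta> (c * y * y ^ q))"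
    using q_gt_1 by (subst sum.remove[of _ 0]) auto
  also have "(\<Sum>t\<in>base_field q - {0}. \<Sum>y\<in>{y. y * y ^ q = t}. \<theta> (c * y * y ^ q))
      = of_nat (q + 1) * (\<Sum>t\<in>base_field q - {0}. \<theta> (c * t))"
    unfolding sum_distrib_left by (intro sum.cong refl fib)
  also have "(\<Sum>t\<in>base_field q - {0}. \<theta> (c * t)) = -1"
    using sum_theta_base_field[OF assms] by (subst (asm) sum.remove[of _ 0]) (auto simp: add_eq_0_iff)
  finally show ?thesis
    by simp
qed

end

section \<open>Sums over independent variables\<close>

text \<open>Isolates one variable as the innermost sum, where the character sums above can evaluate
  it.\<close>

lemma sum_PiE_insert:
  fixes F :: "('k \<Rightarrow> 'a::finite) \<Rightarrow> complex"
  assumes "x \<notin> D"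
  shows "(\<Sum>g\<in>PiE (insert x D) (\<lambda>_. UNIV). F g)
       = (\<Sum>g\<in>PiE D (\<lambda>_. UNIV). \<Sum>y\<in>UNIV. F (g(x := y)))"
proof -
  have "(\<Sum>g\<in>PiE (insert x D) (\<lambda>_. UNIV). F g)
      = (\<Sum>(y, g)\<in>UNIV \<times> PiE D (\<lambda>_. UNIV). F (g(x := y)))"
    unfolding PiE_insert_eq
    by (subst sum.reindex[OF inj_combinator[OF assms]]) (auto simp: case_prod_unfold)
  also have "\<dots> = (\<Sum>y\<in>UNIV. \<Sum>g\<in>PiE D (\<lambda>_. UNIV). F (g(x := y)))"
    by (simp add: sum.cartesian_product)
  finally show ?thesis
    by (subst (asm) sum.swap)
qed

text \<open>The entries of a matrix in \<open>UT n\<close> on and above the diagonal: free variables at the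
  positions in \<open>D\<close>, and 1 elsewhere.\<close>

definition entry :: "'k set \<Rightarrow> ('k \<Rightarrow> 'a::one) \<Rightarrow> 'k \<Rightarrow> 'a" where
  "entry D g x = (if x \<in> D then g x else 1)"

text \<open>The terms of the sum are indexed abstractly: the variable at \<open>pos v\<close> enters
  term \<open>v\<close> as it is, the one at \<open>pos (\<sigma> v)\<close> enters conjugated.
  Later \<open>v\<close> is a pair of arcs and \<sigma> is duality.\<close>

locale hermitian_form = quadratic_char q \<theta>
  for q :: nat and \<theta> :: "'a::{field, finite} \<Rightarrow> complex" +
  fixes pos :: "'i \<Rightarrow> 'k" and \<sigma> :: "'i \<Rightarrow> 'i" and c :: "'i \<Rightarrow> 'a"
begin

definition form :: "'i set \<Rightarrow> 'k set \<Rightarrow> ('k \<Rightarrow> 'a) \<Rightarrow> 'a" where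
  "form V D g = (\<Sum>v\<in>V. c v * entry D g (pos v) * entry D g (pos (\<sigma> v)) ^ q)"

text \<open>The conditions on \<sigma> and \<open>c\<close> make term \<open>\<sigma> v\<close> the
  conjugate of term \<open>v\<close>. Injectivity of \<open>pos\<close> makes distinct orbits of
  \<sigma> use disjoint sets of variables, which is what lets the sum factor.\<close>

definition admissible :: "'i set \<Rightarrow> bool" where
  "admissible V \<longleftrightarrow> finite V \<and> inj_on pos V \<and>
     (\<forall>v\<in>V. \<sigma> v \<in> V \<and> \<sigma> (\<sigma> v) = v \<and> c v \<noteq> 0 \<and> c (\<sigma> v) = c v ^ q)"

lemma admissibleD:
  assumes "admissible V"
  shows "finite V" "inj_on pos V"
    "v \<in> V \<Longrightarrow> \<sigma> v \<in> V" "v \<in> V \<Longrightarrow> \<sigma> (\<sigma> v) = v"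
    "v \<in> V \<Longrightarrow> c v \<noteq> 0" "v \<in> V \<Longrightarrow> c (\<sigma> v) = c v ^ q"
  using assms by (auto simp: admissible_def)

lemma admissible_subset:
  assumes "admissible V" "W \<subseteq> V" "\<And>v. v \<in> W \<Longrightarrow> \<sigma> v \<in> W"
  shows "admissible W"
  using assms unfolding admissible_def by (meson finite_subset inj_on_subset subsetD)

lemma admissible_orbit:
  assumes "admissible V" "v \<in> V"
  shows "admissible {v, \<sigma> v}"
  using assms by (intro admissible_subset[OF assms(1)]) (auto simp: admissibleD)

lemma admissible_Diff_orbit:
  assumes "admissible V" "v \<in> V"
  shows "admissible (V - {v, \<sigma> v})"
proof (rule admissible_subset[OF assms(1)])
  fix w assume "w \<in> V - {v, \<sigma> v}"
  then show "\<sigma> w \<in> V - {v, \<sigma> v}"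
    using assms admissibleD(3,4)[OF assms(1)] by (metis Diff_iff insert_iff empty_iff)
qed auto

text \<open>Conjugation permutes the summands along \<sigma>, so it fixes the sum.\<close>

lemma sum_conj_in_base_field:
  fixes w :: "'i \<Rightarrow> 'a"
  assumes "admissible V" "\<And>v. v \<in> V \<Longrightarrow> w (\<sigma> v) = w v ^ q"
  shows "(\<Sum>v\<in>V. w v) \<in> base_field q"
proof -
  have "(\<Sum>v\<in>V. w v) ^ q = (\<Sum>v\<in>V. w (\<sigma> v))"
    by (simp add: sum_power_q assms)
  also have "\<dots> = (\<Sum>v\<in>V. w v)"
    by (rule sum.reindex_bij_witness[of _ \<sigma> \<sigma>]) (auto simp: admissibleD[OF assms(1)])
  finally show ?thesis
    by (simp add: base_field_def)
qed

lemma form_in_base_field: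
  assumes "admissible V"
  shows "form V D g \<in> base_field q"
  unfolding form_def
  by (rule sum_conj_in_base_field[OF assms])
    (simp add: admissibleD[OF assms] power_mult_distrib mult_ac)

text \<open>Both parts are stable under \<sigma>, so both values lie in the base field, where
  \<theta> is multiplicative.\<close>

lemma theta_form_split:
  assumes "admissible V" "v \<in> V"
  shows "\<theta> (form V D g) = \<theta> (form {v, \<sigma> v} D g) * \<theta> (form (V - {v, \<sigma> v}) D g)"
proof -
  have "form V D g = form {v, \<sigma> v} D g + form (V - {v, \<sigma> v}) D g"
    unfolding form_def using assms
    by (subst sum.subset_diff[of "{v, \<sigma> v}" V]) (auto simp: admissibleD add.commute)
  then show ?thesis
    by (simp add: theta_add form_in_base_field admissible_orbit[OF assms] admissible_Diff_orbit[OF assms])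
qed

text \<open>The two terms of an orbit of size two are conjugate, so together they form a
  trace.\<close>

lemma form_orbit:
  assumes "admissible V" "v \<in> V" "\<sigma> v \<noteq> v"
  defines "m \<equiv> \<lambda>D g. c v * entry D g (pos v) * entry D g (pos (\<sigma> v)) ^ q"
  shows "form {v, \<sigma> v} D g = m D g + m D g ^ q"
  using assms(3) unfolding form_def m_def
  by (simp add: admissibleD[OF assms(1)] assms(2) power_mult_distrib mult_ac)

lemma form_cong:
  assumes "\<And>v. v \<in> V \<Longrightarrow> entry D g (pos v) = entry D' g' (pos v)"
    and "\<And>v. v \<in> V \<Longrightarrow> \<sigma> v \<in> V"
  shows "form V D g = form V D' g'"
  unfolding form_def by (intro sum.cong refl) (simp add: assms)

text \<open>The variable at \<open>pos (\<sigma> v)\<close> occurs in the orbit of \<open>v\<close>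
  alone, and its partner there is the constant 1. So it enters through the trace of a nonzero
  multiple, and summing over it gives zero.\<close>

lemma sum_theta_form_eq_0:
  assumes V: "admissible V" and v: "v \<in> V" "pos v \<notin> D" "pos (\<sigma> v) \<in> D"
  shows "(\<Sum>g\<in>PiE D (\<lambda>_. UNIV). \<theta> (form V D g)) = 0"
proof -
  let ?x = "pos (\<sigma> v)" let ?W = "V - {v, \<sigma> v}"
  note [simp] = admissibleD[OF V]
  have ne: "\<sigma> v \<noteq> v"
    using v by auto
  have D: "D = insert ?x (D - {?x})"
    using v by auto
  have posx: "pos w \<noteq> ?x" if "w \<in> ?W" for w
    using that v inj_onD[OF admissibleD(2)[OF V], of w "\<sigma> v"] by auto
  \<comment> \<open>The factor at \<open>pos v\<close> is 1, so the orbit gives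
    \<open>c v * y ^ q\<close> plus its conjugate \<open>c v ^ q * y\<close>; the two summands are
    swapped to show a trace that is linear in \<open>y\<close>.\<close>
  have orb: "\<theta> (form {v, \<sigma> v} D (g(?x := y))) = \<theta> (c v ^ q * y + (c v ^ q * y) ^ q)" for g y
    using v unfolding form_orbit[OF V v(1) ne]
    by (simp add: entry_def power_mult_distrib add.commute)
  have rest: "form ?W D (g(?x := y)) = form ?W D g" for g y
    using posx v by (intro form_cong) (auto simp: entry_def dest: admissibleD(4)[OF V])
  have "(\<Sum>g\<in>PiE D (\<lambda>_. UNIV). \<theta> (form V D g))
      = (\<Sum>g\<in>PiE (D - {?x}) (\<lambda>_. UNIV). \<Sum>y\<in>UNIV. \<theta> (form V D (g(?x := y))))"
    by (subst D, subst sum_PiE_insert) (use v in \<open>auto simp: insert_absorb\<close>)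
  also have "\<dots> = (\<Sum>g\<in>PiE (D - {?x}) (\<lambda>_. UNIV). 
        (\<Sum>y\<in>UNIV. \<theta> (c v ^ q * y + (c v ^ q * y) ^ q)) * \<theta> (form ?W D g))"
    unfolding theta_form_split[OF V v(1)] orb rest by (simp add: sum_distrib_right)
  also have "\<dots> = 0"
    using v by (subst sum_theta_trace) auto
  finally show ?thesis .
qed

text \<open>Induction on \<open>V\<close>, removing one orbit of \<sigma> at a time. With variables
  in \<open>D\<close>, an orbit of size two sums to \<open>q ^ 2\<close>, which is
  \<open>q ^ 4 / (- q) ^ 2\<close>, and a fixed point to \<open>- q\<close>, which is
  \<open>q ^ 2 / (- q)\<close>. Either way each variable gives \<open>q ^ 2\<close> and each term a
  factor \<open>1 / (- q)\<close>. Variables in no term give \<open>q ^ 2\<close>, and orbits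
  outside \<open>D\<close> give constants.\<close>

lemma sum_theta_form:
  assumes "admissible V" "finite D" "\<And>v. v \<in> V \<Longrightarrow> pos v \<in> D \<longleftrightarrow> pos (\<sigma> v) \<in> D"
  shows "(\<Sum>g\<in>PiE D (\<lambda>_. UNIV). \<theta> (form V D g))
       = of_nat q ^ (2 * card D) * \<theta> (\<Sum>v | v \<in> V \<and> pos v \<notin> D. c v)
         / (- of_nat q) ^ card {v \<in> V. pos v \<in> D}"
  using assms
proof (induction "card V" arbitrary: V D rule: less_induct)
  case less
  note V = less.prems(1) and fin = less.prems(2) and closed = less.prems(3)
  note [simp] = admissibleD[OF V]
  show ?case
  proof (cases "V = {}")
    case True
    then show ?thesis
      using fin by (simp add: form_def card_PiE card_UNIV_eq power_mult)
  next
    case False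
    then obtain v where v: "v \<in> V"
      by blast
    define W where "W = V - {v, \<sigma> v}"
    have W: "admissible W" "card W < card V"
      using admissible_Diff_orbit[OF V v] v unfolding W_def
      by (auto intro!: psubset_card_mono)
    have W_sub: "w \<in> V" "pos w \<noteq> pos v" "pos w \<noteq> pos (\<sigma> v)" "\<sigma> w \<in> W" if "w \<in> W" for w
      using that v inj_onD[OF admissibleD(2)[OF V], of w "\<sigma> v"]
        inj_onD[OF admissibleD(2)[OF V], of w v] admissibleD(3)[OF W(1)]
      by (auto simp: W_def)
    note split = theta_form_split[OF V v, folded W_def]
    have finW: "finite W"
      using W(1) by (rule admissibleD)
    show ?thesis
    proof (cases "pos v \<in> D")
      case False
      then have s: "pos (\<sigma> v) \<notin> D"
        using closed v by blast
      have IH: "(\<Sum>g\<in>PiE D (\<lambda>_. UNIV). \<theta> (form W D g))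
          = of_nat q ^ (2 * card D) * \<theta> (\<Sum>v | v \<in> W \<and> pos v \<notin> D. c v)
         / (- of_nat q) ^ card {v \<in> W. pos v \<in> D}"
        using less.hyps[OF W(2) W(1) fin] closed W_sub(1) by blast
      \<comment> \<open>Both entries are 1, so the orbit contributes a constant and uses up no
        variable; \<open>D\<close> stays the same in the induction.\<close>
      have orb: "form {v, \<sigma> v} D g = (\<Sum>u\<in>{v, \<sigma> v}. c u)" for g
        unfolding form_def using False s v by (intro sum.cong refl) (auto simp: entry_def)
      have eq: "{u \<in> V. pos u \<notin> D} = {v, \<sigma> v} \<union> {u \<in> W. pos u \<notin> D}"
        using False s v by (auto simp: W_def)
      have "(\<Sum>u | u \<in> V \<and> pos u \<notin> D. c u)
          = (\<Sum>u\<in>{v, \<sigma> v}. c u) + (\<Sum>u | u \<in> W \<and> pos u \<notin> D. c u)"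
        unfolding eq using finW by (intro sum.union_disjoint) (auto simp: W_def)
      moreover have "(\<Sum>u\<in>{v, \<sigma> v}. c u) \<in> base_field q"
        using admissible_orbit[OF V v]
        by (rule sum_conj_in_base_field) (use v in \<open>auto intro!: admissibleD[OF V]\<close>)
      moreover have "(\<Sum>u | u \<in> W \<and> pos u \<notin> D. c u) \<in> base_field q"
      proof (rule sum_conj_in_base_field[OF admissible_subset[OF V]])
        show "\<sigma> u \<in> {u \<in> W. pos u \<notin> D}" if "u \<in> {u \<in> W. pos u \<notin> D}" for u
          using that W_sub closed by auto
      qed (use W_sub in auto)
      ultimately have \<theta>: "\<theta> (\<Sum>u | u \<in> V \<and> pos u \<notin> D. c u)
          = \<theta> (\<Sum>u\<in>{v, \<sigma> v}. c u) * \<theta> (\<Sum>u | u \<in> W \<and> pos u \<notin> D. c u)"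
        by (simp add: theta_add)
      have card_eq: "{u \<in> V. pos u \<in> D} = {u \<in> W. pos u \<in> D}"
        using False s by (auto simp: W_def)
      show ?thesis
        unfolding split orb \<theta> card_eq sum_distrib_left[symmetric] IH by simp
    next
      case True
      then have s: "pos (\<sigma> v) \<in> D"
        using closed v by blast
      \<comment> \<open>The variables of the removed orbit go with it; no term of \<open>W\<close>
        uses them.\<close>
      define D' where "D' = D - {pos v, pos (\<sigma> v)}"
      have fin': "finite D'"
        using fin by (simp add: D'_def)
      have WD: "pos w \<in> D' \<longleftrightarrow> pos w \<in> D" if "w \<in> W" for w
        using W_sub[OF that] by (auto simp: D'_def)
      have IH: "(\<Sum>g\<in>PiE D' (\<lambda>_. UNIV). \<theta> (form W D' g))
          = of_nat q ^ (2 * card D') * \<theta> (\<Sum>v | v \<in> W \<and> pos v \<notin> D'. c v)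
         / (- of_nat q) ^ card {v \<in> W. pos v \<in> D'}"
        using less.hyps[OF W(2) W(1) fin'] closed W_sub WD by blast
      have eq: "{v \<in> V. pos v \<notin> D} = {v \<in> W. pos v \<notin> D'}"
        "{v \<in> V. pos v \<in> D} = {v, \<sigma> v} \<union> {v \<in> W. pos v \<in> D'}"
        using True s v WD by (auto simp: W_def D'_def)
      have card_eq: "card {v \<in> V. pos v \<in> D} = card {v, \<sigma> v} + card {v \<in> W. pos v \<in> D'}"
        unfolding eq using finW by (intro card_Un_disjoint) (auto simp: W_def)
      \<comment> \<open>For an orbit of size two the update at \<open>pos (\<sigma> v)\<close> is
        the outer one: the second equation strips it, then the first passes to
        \<open>D'\<close>.\<close>
      have rest: "form W D (g(pos v := y)) = form W D' g"
        "form W D (g(pos (\<sigma> v) := y)) = form W D g" for g y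
        using W_sub WD by (auto intro!: form_cong simp: entry_def)
      show ?thesis
      proof (cases "\<sigma> v = v")
        case self: True
        have D: "D = insert (pos v) D'" "pos v \<notin> D'"
          using True self by (auto simp: D'_def)
        \<comment> \<open>At a fixed point the coefficient is its own conjugate, as the norm sum
          requires.\<close>
        have "c v \<in> base_field q"
          using admissibleD(6)[OF V v] self by (simp add: base_field_def)
        then have norm: "(\<Sum>y\<in>UNIV. \<theta> (c v * y * y ^ q)) = - of_nat q"
          using v by (intro sum_theta_norm) auto
        have orb: "form {v, \<sigma> v} D (g(pos v := y)) = c v * y * y ^ q" for g y
          using True self by (simp add: form_def entry_def)
        have "(\<Sum>g\<in>PiE D (\<lambda>_. UNIV). \<theta> (form V D g))
            = (\<Sum>g\<in>PiE D' (\<lambda>_. UNIV). \<Sum>y\<in>UNIV. \<theta> (form V D (g(pos v := y))))"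
          by (subst (1) D(1), rule sum_PiE_insert[OF D(2)])
        also have "\<dots> = (\<Sum>g\<in>PiE D' (\<lambda>_. UNIV). - of_nat q * \<theta> (form W D' g))"
          unfolding split orb rest sum_distrib_right[symmetric] norm ..
        also have "\<dots> = - of_nat q * (\<Sum>g\<in>PiE D' (\<lambda>_. UNIV). \<theta> (form W D' g))"
          by (simp add: sum_distrib_left)
        finally show ?thesis
          unfolding IH card_eq unfolding eq using q_gt_1 D fin' self
          by (simp add: field_simps power2_eq_square)
      next
        case ne: False
        \<comment> \<open>Injectivity of \<open>pos\<close> makes the two variables of the orbit
          independent.\<close>
        then have pne: "pos (\<sigma> v) \<noteq> pos v"
          using inj_onD[OF admissibleD(2)[OF V], of v "\<sigma> v"] v by auto
        have D: "D = insert (pos (\<sigma> v)) (insert (pos v) D')"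
          "pos (\<sigma> v) \<notin> insert (pos v) D'" "pos v \<notin> D'"
          using True s pne by (auto simp: D'_def)
        have plane: "(\<Sum>y\<in>UNIV. \<Sum>z\<in>UNIV. \<theta> (c v * y * z ^ q + (c v * y * z ^ q) ^ q)) = of_nat q ^ 2"
          using v by (intro sum_theta_hermitian_plane) auto
        have orb: "form {v, \<sigma> v} D (g(pos v := y, pos (\<sigma> v) := z))
            = c v * y * z ^ q + (c v * y * z ^ q) ^ q" for g y z
          using True s pne unfolding form_orbit[OF V v ne] by (simp add: entry_def)
        have "(\<Sum>g\<in>PiE D (\<lambda>_. UNIV). \<theta> (form V D g))
            = (\<Sum>g\<in>PiE D' (\<lambda>_. UNIV). \<Sum>y\<in>UNIV. \<Sum>z\<in>UNIV.
                 \<theta> (form V D (g(pos v := y, pos (\<sigma> v) := z))))"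
          by (subst (1) D(1), subst sum_PiE_insert[OF D(2)], rule sum_PiE_insert[OF D(3)])
        also have "\<dots> = (\<Sum>g\<in>PiE D' (\<lambda>_. UNIV). of_nat q ^ 2 * \<theta> (form W D' g))"
          unfolding split orb rest sum_distrib_right[symmetric] plane ..
        also have "\<dots> = of_nat q ^ 2 * (\<Sum>g\<in>PiE D' (\<lambda>_. UNIV). \<theta> (form W D' g))"
          by (simp add: sum_distrib_left)
        finally show ?thesis
          unfolding IH card_eq unfolding eq using q_gt_1 D fin' ne
          by (simp add: field_simps power2_eq_square)
      qed
    qed
  qed
qed

end

section \<open>The unitriangular group\<close>

text \<open>The fibres of the map sending \<open>g\<close> to \<open>\<phi> g l\<close> are cosets
  of the stabiliser, hence of equal size. The action laws are asked at \<open>l\<close> only,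
  because the identity fixes a functional under \<open>coact\<close> only if it is
  extensional.\<close>

lemma orbit_average:
  fixes F :: "'b \<Rightarrow> complex"
  assumes "group G" "finite (carrier G)"
    and one: "\<phi> \<one>\<^bsub>G\<^esub> l = l"
    and mult: "\<And>g h. g \<in> carrier G \<Longrightarrow> h \<in> carrier G \<Longrightarrow> \<phi> (g \<otimes>\<^bsub>G\<^esub> h) l = \<phi> g (\<phi> h l)"
  shows "of_nat (card (orbit G \<phi> l)) * (\<Sum>g\<in>carrier G. F (\<phi> g l))
       = of_nat (card (carrier G)) * (\<Sum>\<mu>\<in>orbit G \<phi> l. F \<mu>)"
proof -
  interpret group G by fact
  let ?S = "\<lambda>\<mu>. {g \<in> carrier G. \<phi> g l = \<mu>}"
  have orbit: "orbit G \<phi> l = (\<lambda>g. \<phi> g l) ` carrier G"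
    by (auto simp: orbit_def)
  have inv_act: "\<phi> (inv\<^bsub>G\<^esub> g) (\<phi> g l) = l" if "g \<in> carrier G" for g
    using that mult[of "inv\<^bsub>G\<^esub> g" g] one by simp
  have inv_mult: "\<phi> (inv\<^bsub>G\<^esub> g \<otimes>\<^bsub>G\<^esub> h) l = l" if "g \<in> carrier G" "h \<in> carrier G" "\<phi> h l = \<phi> g l" for g h
    using that mult[of "inv\<^bsub>G\<^esub> g" h] mult[of "inv\<^bsub>G\<^esub> g" g] one by simp
  have card: "card (?S \<mu>) = card (?S l)" if \<mu>: "\<mu> \<in> orbit G \<phi> l" for \<mu>
  proof -
    obtain g where g: "g \<in> carrier G" "\<mu> = \<phi> g l"
      using \<mu> unfolding orbit by blast
    \<comment> \<open>Left translation by the inverse of \<open>g\<close> carries the fibre over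
      \<mu> onto the stabiliser of \<open>l\<close>.\<close>
    have "bij_betw (\<lambda>h. inv\<^bsub>G\<^esub> g \<otimes>\<^bsub>G\<^esub> h) (?S \<mu>) (?S l)"
      by (rule bij_betw_byWitness[of _ "\<lambda>h. g \<otimes>\<^bsub>G\<^esub> h"])
        (use g inv_mult inv_act in \<open>auto simp: m_assoc[symmetric] mult\<close>)
    then show ?thesis
      by (rule bij_betw_same_card)
  qed
  have sum: "(\<Sum>g\<in>carrier G. f (\<phi> g l)) = of_nat (card (?S l)) * (\<Sum>\<mu>\<in>orbit G \<phi> l. f \<mu>)"
    for f :: "'b \<Rightarrow> complex"
  proof -
    have "(\<Sum>g\<in>carrier G. f (\<phi> g l)) = (\<Sum>\<mu>\<in>orbit G \<phi> l. \<Sum>g\<in>?S \<mu>. f (\<phi> g l))"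
      unfolding orbit using assms(2) by (intro sum.group[symmetric]) auto
    also have "\<dots> = (\<Sum>\<mu>\<in>orbit G \<phi> l. of_nat (card (?S l)) * f \<mu>)"
      by (intro sum.cong refl) (simp add: card[symmetric])
    finally show ?thesis
      by (simp add: sum_distrib_left)
  qed
  show ?thesis
    \<comment> \<open>The constant function gives the orbit-stabiliser formula, which eliminates the
      order of the stabiliser.\<close>
    using sum[of "\<lambda>_. 1"] sum[of F] by simp
qed

section \<open>Unitriangular matrices and their free coordinates\<close>

lemma UT_simps [simp]: "\<one>\<^bsub>UT n\<^esub> = 1\<^sub>m n" "g \<otimes>\<^bsub>UT n\<^esub> h = g * h"
  by (simp_all add: UT_def)

lemma UT_carrier_iff:
  "g \<in> carrier (UT n) \<longleftrightarrow> g \<in> carrier_mat n n \<and>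
     (\<forall>i<n. \<forall>j<n. (j < i \<longrightarrow> g $$ (i, j) = 0) \<and> (j = i \<longrightarrow> g $$ (i, j) = 1))"
  by (simp add: UT_def)

lemma index_mult_mat_sum:
  assumes "A \<in> carrier_mat n n" "B \<in> carrier_mat n n" "i < n" "j < n"
  shows "(A * B) $$ (i, j) = (\<Sum>k<n. A $$ (i, k) * B $$ (k, j))"
  using assms by (auto simp: scalar_prod_def atLeast0LessThan)

lemma UT_mult_closed:
  assumes "g \<in> carrier (UT n)" "h \<in> carrier (UT n)"
  shows "g * h \<in> carrier (UT n)"
proof -
  have gh: "g \<in> carrier_mat n n" "h \<in> carrier_mat n n"
    using assms by (auto simp: UT_carrier_iff)
  have "(g * h) $$ (i, j) = 0" if "i < n" "j < i" for i j
    using that assms unfolding UT_carrier_iff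
    by (subst index_mult_mat_sum[OF gh], simp, simp, intro sum.neutral ballI)
      (metis lessThan_iff linorder_neqE_nat mult_eq_0_iff order.strict_trans)
  moreover have "(g * h) $$ (i, i) = 1" if "i < n" for i
  proof -
    have "(g * h) $$ (i, i) = (\<Sum>k<n. g $$ (i, k) * h $$ (k, i))"
      using that by (simp add: index_mult_mat_sum[OF gh])
    also have "\<dots> = (\<Sum>k<n. if k = i then 1 else 0)"
      using that assms unfolding UT_carrier_iff
      by (intro sum.cong refl) (metis lessThan_iff linorder_neqE_nat mult_eq_0_iff mult_1)
    finally show ?thesis
      using that by simp
  qed
  ultimately show ?thesis
    using gh by (auto simp: UT_carrier_iff)
qed

lemma UT_mult_ut:
  assumes "g \<in> carrier (UT n)" "x \<in> ut n"
  shows "g * x \<in> ut n" "x * g \<in> ut n"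
proof -
  have gx: "g \<in> carrier_mat n n" "x \<in> carrier_mat n n"
    using assms by (auto simp: UT_carrier_iff ut_def)
  have "(g * x) $$ (i, j) = 0" "(x * g) $$ (i, j) = 0" if "i < n" "j \<le> i" for i j
  proof -
    have j: "j < n"
      using that by simp
    have "g $$ (i, k) * x $$ (k, j) = 0" "x $$ (i, k) * g $$ (k, j) = 0" if "k < n" for k
      using that \<open>i < n\<close> j \<open>j \<le> i\<close> assms unfolding UT_carrier_iff ut_def
      by (cases "k < i"; cases "j < k"; simp)+
    then show "(g * x) $$ (i, j) = 0" "(x * g) $$ (i, j) = 0"
      using that j by (simp_all only: index_mult_mat_sum[OF gx] index_mult_mat_sum[OF gx(2,1)])
        (auto intro!: sum.neutral)
  qed
  then show "g * x \<in> ut n" "x * g \<in> ut n"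
    using gx by (auto simp: ut_def)
qed

definition strict_pairs :: "nat \<Rightarrow> (nat \<times> nat) set" where
  "strict_pairs n = {(i, j). i < j \<and> j < n}"

lemma finite_strict_pairs: "finite (strict_pairs n)"
  by (rule finite_subset[of _ "{..<n} \<times> {..<n}"]) (auto simp: strict_pairs_def)

definition UT_of :: "nat \<Rightarrow> (nat \<times> nat \<Rightarrow> 'a::field) \<Rightarrow> 'a mat" where
  "UT_of n r = mat n n (\<lambda>(i, j). if i < j then r (i, j) else if i = j then 1 else 0)"

text \<open>The strictly upper entries are free coordinates, so a sum over the group becomes a sum
  over independent variables.\<close>

lemma bij_betw_UT_of:
  "bij_betw (UT_of n) (PiE (strict_pairs n) (\<lambda>_. UNIV :: 'a::field set)) (carrier (UT n))"
proof (rule bij_betw_byWitness[of _ "\<lambda>g. restrict (\<lambda>ij. g $$ ij) (strict_pairs n)"])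
  show "\<forall>g\<in>carrier (UT n). UT_of n (restrict (\<lambda>ij. g $$ ij) (strict_pairs n)) = g"
    by (auto simp: UT_of_def UT_carrier_iff strict_pairs_def intro!: eq_matI)
qed (auto simp: UT_of_def UT_carrier_iff strict_pairs_def fun_eq_iff PiE_def extensional_def)

lemma finite_UT: "finite (carrier (UT n :: 'a::{field, finite} mat monoid))"
  using bij_betw_finite[OF bij_betw_UT_of] finite_PiE[OF finite_strict_pairs]
  by (metis finite)

lemma card_UT:
  "card (carrier (UT n :: 'a::{field, finite} mat monoid)) = card (UNIV :: 'a set) ^ card (strict_pairs n)"
  using bij_betw_same_card[OF bij_betw_UT_of[of n, where ?'a = 'a]]
  by (simp add: card_PiE finite_strict_pairs)

text \<open>Determinant 1 gives a right inverse among all matrices, which makes right multiplication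
  by \<open>g\<close> injective. On the finite set of unitriangular matrices it is then surjective,
  so the identity is attained and an inverse of the right shape exists.\<close>

lemma group_UT: "group (UT n :: 'a::{field, finite} mat monoid)"
proof (rule groupI)
  fix g :: "'a mat" assume g: "g \<in> carrier (UT n)"
  then have gm: "g \<in> carrier_mat n n"
    by (simp add: UT_carrier_iff)
  have "diag_mat g = map (\<lambda>_. 1) [0..<n]"
    using g by (auto simp: diag_mat_def UT_carrier_iff)
  then have "det g = 1"
    using g det_upper_triangular[of g n] unfolding UT_carrier_iff
    by (auto simp: map_replicate_const upper_triangular_def)
  then obtain B where B: "B \<in> carrier_mat n n" "g * B = 1\<^sub>m n"
    using det_non_zero_imp_unit[OF gm, of "()"] by (auto simp: Units_def ring_mat_def)
  have "inj_on (\<lambda>h. h * g) (carrier (UT n))"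
  proof (rule inj_onI)
    fix h h' :: "'a mat" assume h: "h \<in> carrier (UT n)" "h' \<in> carrier (UT n)" "h * g = h' * g"
    then have hm: "h \<in> carrier_mat n n" "h' \<in> carrier_mat n n"
      by (simp_all add: UT_carrier_iff)
    have "h * (g * B) = h' * (g * B)"
      using h(3) assoc_mult_mat[OF hm(1) gm B(1)] assoc_mult_mat[OF hm(2) gm B(1)] by simp
    then show "h = h'"
      using hm by (simp add: B(2))
  qed
  then have "(\<lambda>h. h * g) ` carrier (UT n) = carrier (UT n)"
    using g by (intro endo_inj_surj finite_UT) (auto intro: UT_mult_closed)
  moreover have "1\<^sub>m n \<in> carrier (UT n)"
    by (auto simp: UT_carrier_iff)
  ultimately show "\<exists>h\<in>carrier (UT n). h \<otimes>\<^bsub>UT n\<^esub> g = \<one>\<^bsub>UT n\<^esub>"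
    unfolding UT_simps by (metis imageE)
next
  fix g h k :: "'a mat"
  assume "g \<in> carrier (UT n)" "h \<in> carrier (UT n)" "k \<in> carrier (UT n)"
  then show "g \<otimes>\<^bsub>UT n\<^esub> h \<otimes>\<^bsub>UT n\<^esub> k = g \<otimes>\<^bsub>UT n\<^esub> (h \<otimes>\<^bsub>UT n\<^esub> k)"
    by (auto simp: UT_carrier_iff)
next
  fix g :: "'a mat" assume "g \<in> carrier (UT n)"
  then show "\<one>\<^bsub>UT n\<^esub> \<otimes>\<^bsub>UT n\<^esub> g = g"
    by (auto simp: UT_carrier_iff)
next
  show "\<one>\<^bsub>UT n\<^esub> \<in> carrier (UT n :: 'a mat monoid)"
    by (auto simp: UT_carrier_iff)
qed (simp add: UT_mult_closed)

section \<open>Reflection of indices and the dagger\<close>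

lemma bar_less [simp]: "i < n \<Longrightarrow> bar n i < n"
  by (simp add: bar_def)

lemma bar_bar [simp]: "i < n \<Longrightarrow> bar n (bar n i) = i"
  by (simp add: bar_def)

lemma bar_less_iff: "i < n \<Longrightarrow> j < n \<Longrightarrow> bar n i < bar n j \<longleftrightarrow> j < i"
  by (auto simp: bar_def)

lemma bar_le_iff: "i < n \<Longrightarrow> j < n \<Longrightarrow> bar n i \<le> bar n j \<longleftrightarrow> j \<le> i"
  by (auto simp: bar_def)

lemma bar_eq_iff: "i < n \<Longrightarrow> j < n \<Longrightarrow> bar n i = bar n j \<longleftrightarrow> i = j"
  by (auto simp: bar_def)

lemma sum_bar: "(\<Sum>k<n. f (bar n k)) = (\<Sum>k<n. f k)"
  by (rule sum.reindex_bij_witness[of _ "bar n" "bar n"]) auto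

lemma dagger_dim [simp]: "dim_row (dagger n q x) = n" "dim_col (dagger n q x) = n"
  by (simp_all add: dagger_def antidiag_def)

lemma dagger_carrier [simp]: "dagger n q x \<in> carrier_mat n n"
  by (rule carrier_matI) simp_all

text \<open>Each product with \<open>antidiag n\<close> leaves a single summand, so the dagger
  reflects in the antidiagonal and conjugates the entries.\<close>

lemma dagger_index:
  assumes "x \<in> carrier_mat n n" "i < n" "j < n"
  shows "dagger n q x $$ (i, j) = (x $$ (bar n j, bar n i)) ^ q"
proof -
  let ?A = "antidiag n :: 'a mat" and ?T = "transpose_mat (map_mat (\<lambda>a. a ^ q) x)"
  have AT: "?A \<in> carrier_mat n n" "?T \<in> carrier_mat n n"
    using assms by (auto simp: antidiag_def)
  have A: "?A $$ (k, m) = (if m = bar n k then 1 else 0)" if "k < n" "m < n" for k m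
    using that by (simp add: antidiag_def)
  have l: "(?A * ?T) $$ (i, k) = ?T $$ (bar n i, k)" if "k < n" for k
  proof -
    have "(?A * ?T) $$ (i, k) = (\<Sum>m<n. if m = bar n i then ?T $$ (m, k) else 0)"
      unfolding index_mult_mat_sum[OF AT \<open>i < n\<close> that]
      using assms by (intro sum.cong refl) (simp add: A)
    then show ?thesis
      using assms by simp
  qed
  have "dagger n q x $$ (i, j) = (\<Sum>k<n. (?A * ?T) $$ (i, k) * ?A $$ (k, j))"
    unfolding dagger_def using AT assms by (intro index_mult_mat_sum) auto
  also have "\<dots> = (\<Sum>k<n. if k = bar n j then ?T $$ (bar n i, k) else 0)"
    using assms by (intro sum.cong refl) (auto simp: l A)
  also have "\<dots> = (x $$ (bar n j, bar n i)) ^ q"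
    using assms by simp
  finally show ?thesis .
qed

lemma UT_carrier_mat: "g \<in> carrier (UT n) \<Longrightarrow> g \<in> carrier_mat n n"
  by (simp add: UT_carrier_iff)

lemma uu_carrier_mat: "x \<in> uu n q \<Longrightarrow> x \<in> carrier_mat n n"
  by (simp add: uu_def ut_def)

context quadratic_char
begin

lemma dagger_mult:
  assumes "x \<in> carrier_mat n n" "y \<in> carrier_mat n n"
  shows "dagger n q (x * y :: 'a mat) = dagger n q y * dagger n q x"
proof (rule eq_matI)
  fix i j assume "i < dim_row (dagger n q y * dagger n q x)" "j < dim_col (dagger n q y * dagger n q x)"
  then have ij: "i < n" "j < n"
    by simp_all
  have "dagger n q (x * y) $$ (i, j) = (\<Sum>k<n. x $$ (bar n j, k) * y $$ (k, bar n i)) ^ q"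
    using ij assms by (simp only: dagger_index mult_carrier_mat) (simp add: index_mult_mat_sum[OF assms] del: index_mult_mat)
  \<comment> \<open>Conjugation passes through the sum by additivity; reversing the inner index with
    \<open>bar\<close> matches the entries of the two daggers.\<close>
  also have "\<dots> = (\<Sum>k<n. (x $$ (bar n j, bar n k) * y $$ (bar n k, bar n i)) ^ q)"
    unfolding sum_power_q by (rule sum_bar[symmetric])
  also have "\<dots> = (dagger n q y * dagger n q x) $$ (i, j)"
    using ij assms
    by (subst index_mult_mat_sum[of _ n]) (auto simp: dagger_index power_mult_distrib mult.commute)
  finally show "dagger n q (x * y) $$ (i, j) = (dagger n q y * dagger n q x) $$ (i, j)" .
qed simp_all

lemma dagger_dagger:
  assumes "x \<in> carrier_mat n n"
  shows "dagger n q (dagger n q (x :: 'a mat)) = x"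
  using assms by (intro eq_matI) (auto simp: dagger_index)

lemma dagger_UT: "(g :: 'a mat) \<in> carrier (UT n) \<Longrightarrow> dagger n q g \<in> carrier (UT n)"
  unfolding UT_carrier_iff by (auto simp: dagger_index bar_less_iff) (metis bar_less power_one)

section \<open>The group actions and the character as an average\<close>

lemma act_mult:
  assumes "(g :: 'a mat) \<in> carrier (UT n)" "h \<in> carrier (UT n)" "x \<in> uu n q"
  shows "act n q (g * h) x = act n q g (act n q h x)"
proof -
  have [simp]: "g \<in> carrier_mat n n" "h \<in> carrier_mat n n" "x \<in> carrier_mat n n"
    using assms by (auto simp: UT_carrier_mat uu_carrier_mat)
  have [simp]: "dagger n q g \<in> carrier_mat n n" "dagger n q h \<in> carrier_mat n n"
    by simp_all
  have "act n q (g * h) x = g * h * x * (dagger n q h * dagger n q g)"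
    by (simp add: act_def dagger_mult[of _ n])
  also have "\<dots> = g * h * x * dagger n q h * dagger n q g"
    by (rule assoc_mult_mat[symmetric, of _ n n _ n _ n]) (auto intro!: mult_carrier_mat[of _ n n])
  also have "g * h * x = g * (h * x)"
    by (rule assoc_mult_mat[of _ n n _ n _ n]) auto
  also have "g * (h * x) * dagger n q h = g * (h * x * dagger n q h)"
    by (rule assoc_mult_mat[of _ n n _ n _ n]) (auto intro!: mult_carrier_mat[of _ n n])
  finally show ?thesis
    by (simp add: act_def)
qed

lemma act_one:
  assumes "(x :: 'a mat) \<in> uu n q"
  shows "act n q (1\<^sub>m n) x = x"
proof -
  have "dagger n q (1\<^sub>m n :: 'a mat) = 1\<^sub>m n"
    by (intro eq_matI) (auto simp: dagger_index bar_eq_iff)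
  then show ?thesis
    using uu_carrier_mat[OF assms] by (simp add: act_def)
qed

text \<open>The dagger is an involution that reverses products: writing \<open>y'\<close> for the
  dagger of \<open>y\<close>, the dagger of \<open>g x g'\<close> is \<open>g x' g'\<close>, and
  \<open>x' = - x\<close>.\<close>

lemma act_uu:
  assumes "(g :: 'a mat) \<in> carrier (UT n)" "x \<in> uu n q"
  shows "act n q g x \<in> uu n q"
proof -
  have x: "x \<in> ut n" "dagger n q x = - x"
    using assms by (auto simp: uu_def)
  have [simp]: "g \<in> carrier_mat n n" "x \<in> carrier_mat n n"
    using assms by (auto simp: UT_carrier_mat uu_carrier_mat)
  have [simp]: "dagger n q g \<in> carrier_mat n n"
    by simp
  have [simp]: "g * x \<in> carrier_mat n n"
    by (rule mult_carrier_mat[of _ n n]) auto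
  have "dagger n q (act n q g x) = g * (- x * dagger n q g)"
    using x by (simp add: act_def dagger_mult[of _ n] dagger_dagger[of _ n])
  also have "\<dots> = - (g * (x * dagger n q g))"
    using carrier_matD[OF \<open>g \<in> carrier_mat n n\<close>] carrier_matD[OF \<open>x \<in> carrier_mat n n\<close>] by simp
  also have "\<dots> = - act n q g x"
    unfolding act_def by (subst assoc_mult_mat[of g n n x n _ n]) auto
  finally show ?thesis
    using UT_mult_ut(2)[OF dagger_UT[OF assms(1)] UT_mult_ut(1)[OF assms(1) x(1)]]
    by (simp add: uu_def act_def)
qed

text \<open>Averaging over the group replaces the normalised orbit sum and cancels the size of the
  orbit under \<open>UT n\<close>; the size of the orbit under \<open>HH n\<close> remains as a
  factor.\<close>

lemma chi_average:
  fixes f :: "'a mat \<Rightarrow> 'a mat"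
  assumes l: "l \<in> extensional (uu n q)" and u: "f u \<in> uu n q"
  shows "chi n q f \<theta> l u = of_nat (card (orbit (HH n) (coact n q) l)) *
     (\<Sum>g\<in>carrier (UT n). \<theta> (l (act n q g (f u)))) / of_nat (card (carrier (UT n :: 'a mat monoid)))"
proof -
  let ?G = "UT n :: 'a mat monoid"
  interpret group ?G
    by (rule group_UT)
  have one: "coact n q \<one>\<^bsub>?G\<^esub> l = l"
  proof (rule extensionalityI[OF _ l])
    fix x :: "'a mat" assume "x \<in> uu n q"
    then show "coact n q \<one>\<^bsub>?G\<^esub> l x = l x"
      unfolding coact_def inv_one by (simp add: act_one)
  qed (simp add: coact_def)
  have mult: "coact n q (g \<otimes>\<^bsub>?G\<^esub> h) l = coact n q g (coact n q h l)"
    if "g \<in> carrier ?G" "h \<in> carrier ?G" for g h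
    unfolding coact_def inv_mult_group[OF that]
    using that by (intro restrict_ext) (simp add: act_mult act_uu)
  have "of_nat (card (orbit ?G (coact n q) l)) * (\<Sum>g\<in>carrier ?G. \<theta> (coact n q g l (f u)))
      = of_nat (card (carrier ?G)) * (\<Sum>\<mu>\<in>orbit ?G (coact n q) l. \<theta> (\<mu> (f u)))"
    by (rule orbit_average[OF group_UT finite_UT one mult, where F = "\<lambda>\<mu>. \<theta> (\<mu> (f u))"])
  also have "(\<Sum>g\<in>carrier ?G. \<theta> (coact n q g l (f u))) = (\<Sum>g\<in>carrier ?G. \<theta> (l (act n q (inv\<^bsub>?G\<^esub> g) (f u))))"
    using u by (simp add: coact_def)
  \<comment> \<open>Inversion permutes the group, which removes the inverse built into
    \<open>coact\<close>.\<close>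
  also have "\<dots> = (\<Sum>g\<in>carrier ?G. \<theta> (l (act n q g (f u))))"
    by (rule sum.reindex_bij_witness[of _ "\<lambda>g. inv\<^bsub>?G\<^esub> g" "\<lambda>g. inv\<^bsub>?G\<^esub> g"]) auto
  finally have eq: "of_nat (card (orbit ?G (coact n q) l)) * (\<Sum>g\<in>carrier ?G. \<theta> (l (act n q g (f u))))
      = of_nat (card (carrier ?G)) * (\<Sum>\<mu>\<in>orbit ?G (coact n q) l. \<theta> (\<mu> (f u)))" .
  have "orbit ?G (coact n q) l = (\<lambda>g. coact n q g l) ` carrier ?G"
    by (auto simp: orbit_def)
  then have "card (orbit ?G (coact n q) l) \<noteq> 0"
    using finite_UT one_closed by (auto simp: card_eq_0_iff)
  moreover have "card (carrier ?G) \<noteq> 0"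
    using finite_UT one_closed by (auto simp: card_eq_0_iff)
  ultimately show ?thesis
    unfolding chi_def using eq by (simp add: field_simps)
qed

end

section \<open>Pairs of nested arcs\<close>

definition arc_dual :: "nat \<Rightarrow> nat \<Rightarrow> nat \<times> 'a::field \<times> nat \<Rightarrow> nat \<times> 'a \<times> nat" where
  "arc_dual n q = (\<lambda>(i, a, j). (bar n j, - (a ^ q), bar n i))"

type_synonym 'a arc_pair = "(nat \<times> 'a \<times> nat) \<times> (nat \<times> 'a \<times> nat)"

text \<open>The position of the unconjugated entry of \<open>g\<close> in the term of this pair; the
  conjugated entry sits at the position of the dual pair.\<close>

definition pair_pos :: "'a arc_pair \<Rightarrow> nat \<times> nat" where
  "pair_pos = (\<lambda>((i, a, j), (k, b, l)). (i, k))"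

definition pair_coeff :: "'a::field arc_pair \<Rightarrow> 'a" where
  "pair_coeff = (\<lambda>((i, a, j), (k, b, l)). a * b)"

text \<open>Nesting is weak: shared endpoints correspond to diagonal entries of \<open>g\<close>.
  Other pairs meet an entry below the diagonal.\<close>

definition nested_pairs :: "(nat \<times> 'a \<times> nat) set \<Rightarrow> (nat \<times> 'a \<times> nat) set \<Rightarrow> 'a arc_pair set" where
  "nested_pairs \<eta> \<nu> = {((i, a, j), (k, b, l)). (i, a, j) \<in> \<eta> \<and> (k, b, l) \<in> \<nu> \<and> i \<le> k \<and> l \<le> j}"

section \<open>Set partitions and their matrices\<close>

lemma set_partitionD:
  assumes "set_partition n \<eta>" "(i, a, j) \<in> \<eta>"
  shows "i < j" "j < n" "i < n" "a \<noteq> 0"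
    "(i, b, k) \<in> \<eta> \<Longrightarrow> b = a \<and> k = j"
    "(k, b, j) \<in> \<eta> \<Longrightarrow> b = a \<and> k = i"
proof -
  have "i < j \<and> j < n \<and> a \<noteq> 0"
    using assms unfolding set_partition_def by (metis (mono_tags, lifting) case_prod_conv)
  then show "i < j" "j < n" "i < n" "a \<noteq> 0"
    by auto
  have eq: "(i, a, j) = (k, b, l)" if "(k, b, l) \<in> \<eta>" "i = k \<or> j = l" for k b l
    using assms(1)[unfolded set_partition_def, THEN conjunct2, rule_format, OF assms(2), unfolded prod.case, rule_format, OF that(1)] that(2)
    by blast
  show "(i, b, k) \<in> \<eta> \<Longrightarrow> b = a \<and> k = j" "(k, b, j) \<in> \<eta> \<Longrightarrow> b = a \<and> k = i"
    using eq by blast+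
qed

text \<open>An arc of a set partition is determined by its left endpoint.\<close>

lemma nested_pairs_eqI:
  assumes "set_partition n \<eta>" "set_partition n \<nu>"
    and "v \<in> nested_pairs \<eta> \<nu>" "w \<in> nested_pairs \<eta> \<nu>"
    and "fst (fst v) = fst (fst w)" "fst (snd v) = fst (snd w)"
  shows "v = w"
proof -
  obtain i a j k b l where v: "v = ((i, a, j), (k, b, l))" "(i, a, j) \<in> \<eta>" "(k, b, l) \<in> \<nu>"
    using assms(3) by (auto simp: nested_pairs_def)
  obtain a' j' b' l' where w: "w = ((i, a', j'), (k, b', l'))" "(i, a', j') \<in> \<eta>" "(k, b', l') \<in> \<nu>"
    using assms(4-6) v(1) by (auto simp: nested_pairs_def)
  show ?thesis
    using set_partitionD(5)[OF assms(1) v(2) w(2)] set_partitionD(5)[OF assms(2) v(3) w(3)] v(1) w(1) by simp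
qed

lemma finite_set_partition:
  assumes "set_partition n (\<eta> :: (nat \<times> 'a::{field, finite} \<times> nat) set)"
  shows "finite \<eta>"
proof (rule finite_subset)
  show "\<eta> \<subseteq> {..<n} \<times> UNIV \<times> {..<n}"
    using set_partitionD[OF assms] by auto
qed simp

lemma x_of_index:
  assumes "set_partition n \<eta>" "(i, a, j) \<in> \<eta>"
  shows "x_of n \<eta> $$ (i, j) = a"
proof -
  have "(THE b. (i, b, j) \<in> \<eta>) = a"
    using assms set_partitionD(5)[OF assms] by blast
  then show ?thesis
    using assms set_partitionD(1-3)[OF assms] by (auto simp: x_of_def arc_def)
qed

lemma x_of_index_0:
  assumes "i < n" "j < n" "\<And>a. (i, a, j) \<notin> \<eta>"
  shows "x_of n \<eta> $$ (i, j) = 0"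
  using assms by (simp add: x_of_def arc_def)

text \<open>The matrix is supported on the endpoint pairs of arcs, and these determine the
  arcs.\<close>

lemma sum_x_of:
  fixes \<nu> :: "(nat \<times> 'a::{field, finite} \<times> nat) set"
  assumes \<nu>: "set_partition n \<nu>"
  shows "(\<Sum>k<n. \<Sum>l<n. x_of n \<nu> $$ (k, l) * w k l) = (\<Sum>(k, b, l)\<in>\<nu>. b * w k l)"
proof -
  let ?ends = "\<lambda>(k, b, l). (k, l)"
  have "(\<Sum>(k, b, l)\<in>\<nu>. b * w k l) = (\<Sum>(k, l)\<in>?ends ` \<nu>. x_of n \<nu> $$ (k, l) * w k l)"
    by (subst sum.reindex)
      (auto simp: x_of_index[OF \<nu>] inj_on_def dest: set_partitionD(5)[OF \<nu>] intro!: sum.cong)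
  also have "\<dots> = (\<Sum>(k, l)\<in>{..<n} \<times> {..<n}. x_of n \<nu> $$ (k, l) * w k l)"
  proof (rule sum.mono_neutral_left)
    show "?ends ` \<nu> \<subseteq> {..<n} \<times> {..<n}"
      using set_partitionD[OF \<nu>] by auto
    show "\<forall>kl\<in>{..<n} \<times> {..<n} - ?ends ` \<nu>. (case kl of (k, l) \<Rightarrow> x_of n \<nu> $$ (k, l) * w k l) = 0"
      by (force intro!: x_of_index_0)
  qed simp
  finally show ?thesis
    by (simp add: sum.cartesian_product)
qed

context quadratic_char
begin

section \<open>Twisted set partitions and their functionals on the orbit of
  \<open>x_of\<close>\<close>

lemma twisted_set_partitionD:
  assumes "twisted_set_partition n q \<eta>"
  shows "set_partition n \<eta>" "e \<in> \<eta> \<Longrightarrow> arc_dual n q e \<in> \<eta>"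
proof -
  show "set_partition n \<eta>"
    using assms unfolding twisted_set_partition_def by blast
  show "arc_dual n q e \<in> \<eta>" if "e \<in> \<eta>"
    using assms[unfolded twisted_set_partition_def, THEN conjunct2, rule_format, OF that]
    by (simp add: arc_dual_def case_prod_unfold)
qed

text \<open>Closure under dual arcs is the condition on the dagger read entrywise: the dual label
  \<open>- (a ^ q)\<close> has conjugate \<open>- a\<close>, and a position without an arc has a
  dual position without one.\<close>

lemma x_of_uu:
  fixes \<eta> :: "(nat \<times> 'a \<times> nat) set"
  assumes "twisted_set_partition n q \<eta>"
  shows "x_of n \<eta> \<in> uu n q"
proof -
  note part = twisted_set_partitionD(1)[OF assms]
  have carrier: "x_of n \<eta> \<in> carrier_mat n n"
    by (simp add: x_of_def)
  have "x_of n \<eta> $$ (i, j) = 0" if "i < n" "j \<le> i" for i j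
    using that set_partitionD(1)[OF part, of i _ j] by (intro x_of_index_0) force+
  moreover have "(x_of n \<eta> $$ (bar n j, bar n i)) ^ q = - (x_of n \<eta> $$ (i, j))" if "i < n" "j < n" for i j
  proof (cases "\<exists>a. (i, a, j) \<in> \<eta>")
    case True
    then obtain a where a: "(i, a, j) \<in> \<eta>"
      by blast
    then have "(bar n j, - (a ^ q), bar n i) \<in> \<eta>"
      using twisted_set_partitionD(2)[OF assms, of "(i, a, j)"] by (simp add: arc_dual_def)
    then show ?thesis
      using a by (simp add: x_of_index[OF part] uminus_power_q)
  next
    case False
    have "(bar n j, a, bar n i) \<notin> \<eta>" for a
      using False that twisted_set_partitionD(2)[OF assms, of "(bar n j, a, bar n i)"]
      by (auto simp: arc_dual_def)
    then show ?thesis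
      using False that by (simp add: x_of_index_0)
  qed
  ultimately show ?thesis
    using carrier unfolding uu_def ut_def
    by (auto simp: dagger_index intro!: eq_matI)
qed

lemma act_index:
  fixes g x :: "'a mat"
  assumes "g \<in> carrier_mat n n" "x \<in> carrier_mat n n" "i < n" "j < n"
  shows "act n q g x $$ (i, j)
       = (\<Sum>k<n. \<Sum>l<n. x $$ (k, l) * (g $$ (i, k) * g $$ (bar n j, bar n l) ^ q))"
proof -
  have gx: "g * x \<in> carrier_mat n n"
    using assms by simp
  have "act n q g x $$ (i, j) = (\<Sum>l<n. \<Sum>k<n. x $$ (k, l) * (g $$ (i, k) * g $$ (bar n j, bar n l) ^ q))"
    unfolding act_def index_mult_mat_sum[OF gx dagger_carrier assms(3,4)]
    using assms by (intro sum.cong refl)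
      (simp add: index_mult_mat_sum[OF assms(1,2)] dagger_index sum_distrib_left mult_ac del: index_mult_mat)
  then show ?thesis
    by (subst sum.swap)
qed

lemma lambda_of_act:
  fixes \<eta> \<nu> :: "(nat \<times> 'a \<times> nat) set"
  assumes \<eta>: "set_partition n \<eta>" and \<nu>: "twisted_set_partition n q \<nu>" and g: "g \<in> carrier (UT n)"
  shows "lambda_of n q \<eta> (act n q g (x_of n \<nu>))
       = (\<Sum>((i, a, j), (k, b, l))\<in>nested_pairs \<eta> \<nu>. a * b * g $$ (i, k) * g $$ (bar n j, bar n l) ^ q)"
proof -
  note \<nu>' = twisted_set_partitionD(1)[OF \<nu>]
  have gm: "g \<in> carrier_mat n n" "x_of n \<nu> \<in> carrier_mat n n"
    using g by (auto simp: UT_carrier_mat x_of_def)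
  have "lambda_of n q \<eta> (act n q g (x_of n \<nu>)) = (\<Sum>(i, a, j)\<in>\<eta>. a * act n q g (x_of n \<nu>) $$ (i, j))"
    by (simp add: lambda_of_def act_uu[OF g] x_of_uu[OF \<nu>])
  also have "\<dots> = (\<Sum>(i, a, j)\<in>\<eta>. \<Sum>(k, b, l)\<in>\<nu>. a * b * g $$ (i, k) * g $$ (bar n j, bar n l) ^ q)"
  proof (rule sum.cong[OF refl], clarify)
    fix i a j assume "(i, a, j) \<in> \<eta>"
    then have "i < n" "j < n"
      using set_partitionD(2,3)[OF \<eta>] by blast+
    then show "a * act n q g (x_of n \<nu>) $$ (i, j)
        = (\<Sum>(k, b, l)\<in>\<nu>. a * b * g $$ (i, k) * g $$ (bar n j, bar n l) ^ q)"
      by (simp add: act_index[OF gm] sum_x_of[OF \<nu>'] sum_distrib_left case_prod_unfold mult.assoc)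
  qed
  also have "\<dots> = (\<Sum>((i, a, j), (k, b, l))\<in>\<eta> \<times> \<nu>. a * b * g $$ (i, k) * g $$ (bar n j, bar n l) ^ q)"
    by (simp add: sum.cartesian_product case_prod_unfold)
  also have "\<dots> = (\<Sum>((i, a, j), (k, b, l))\<in>nested_pairs \<eta> \<nu>. a * b * g $$ (i, k) * g $$ (bar n j, bar n l) ^ q)"
  proof (rule sum.mono_neutral_right)
    show "finite (\<eta> \<times> \<nu>)"
      using finite_set_partition[OF \<eta>] finite_set_partition[OF \<nu>'] by simp
    \<comment> \<open>If \<open>k < i\<close> the first entry is below the diagonal. If
      \<open>j < l\<close> the second is, because \<open>bar\<close> reverses the order.\<close>
    have "g $$ (i, k) = 0 \<or> g $$ (bar n j, bar n l) = 0"
      if "(i, a, j) \<in> \<eta>" "(k, b, l) \<in> \<nu>" "\<not> (i \<le> k \<and> l \<le> j)" for i a j k b l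
    proof (cases "i \<le> k")
      case True
      then have "bar n l < bar n j" "bar n j < n" "bar n l < n"
        using that set_partitionD(1-3)[OF \<eta> that(1)] set_partitionD(1-3)[OF \<nu>' that(2)]
        by (auto simp: bar_less_iff)
      then show ?thesis
        using g by (simp add: UT_carrier_iff)
    next
      case False
      then show ?thesis
        using that set_partitionD(1-3)[OF \<eta> that(1)] set_partitionD(1-3)[OF \<nu>' that(2)] g
        by (simp add: UT_carrier_iff)
    qed
    then show "\<forall>p\<in>\<eta> \<times> \<nu> - nested_pairs \<eta> \<nu>.
      (\<lambda>((i, a, j), (k, b, l)). a * b * g $$ (i, k) * g $$ (bar n j, bar n l) ^ q) p = 0"
      using q_gt_1 by (fastforce simp: nested_pairs_def)
  qed (auto simp: nested_pairs_def)
  finally show ?thesis .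
qed

text \<open>The sum over the group is a Hermitian form sum whose terms are the weakly nested pairs
  and whose variables are the strictly upper positions. The condition on arcs says that no such pair
  shares exactly one endpoint; this decides between the product formula and vanishing.\<close>

lemma sum_theta_lambda_of:
  fixes \<eta> \<nu> :: "(nat \<times> 'a \<times> nat) set"
  assumes \<eta>: "twisted_set_partition n q \<eta>" and \<nu>: "twisted_set_partition n q \<nu>"
  shows "(\<Sum>g\<in>carrier (UT n). \<theta> (lambda_of n q \<eta> (act n q g (x_of n \<nu>)))) =
    (if \<forall>i j k. arc \<eta> i j \<and> i < k \<and> k < j \<longrightarrow> \<not> arc \<nu> i k \<and> \<not> arc \<nu> k j
     then of_nat (card (carrier (UT n :: 'a mat monoid))) / (- of_nat q) ^ nst \<eta> \<nu> *
          \<theta> (\<Sum>(i, a, b, j) \<in> {(i, a, b, j). (i, a, j) \<in> \<eta> \<and> (i, b, j) \<in> \<nu>}. a * b)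
     else 0)"
proof -
  note \<eta>' = twisted_set_partitionD[OF \<eta>] and \<nu>' = twisted_set_partitionD[OF \<nu>]
  note \<eta>D = set_partitionD[OF \<eta>'(1)] and \<nu>D = set_partitionD[OF \<nu>'(1)]
  let ?D = "strict_pairs n" and ?V = "nested_pairs \<eta> \<nu>"
  let ?\<sigma> = "map_prod (arc_dual n q) (arc_dual n q) :: 'a arc_pair \<Rightarrow> 'a arc_pair"
  interpret hermitian_form q \<theta> pair_pos ?\<sigma> pair_coeff ..
  have V: "admissible ?V"
    unfolding admissible_def
  proof (intro conjI ballI)
    have "?V \<subseteq> \<eta> \<times> \<nu>"
      by (auto simp: nested_pairs_def)
    then show "finite ?V"
      by (rule finite_subset) (simp add: finite_set_partition[OF \<eta>'(1)] finite_set_partition[OF \<nu>'(1)])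
    show "inj_on pair_pos ?V"
      by (rule inj_onI, rule nested_pairs_eqI[OF \<eta>'(1) \<nu>'(1)]) (auto simp: pair_pos_def case_prod_unfold)
  next
    fix v assume "v \<in> ?V"
    then obtain i a j k b l where v: "v = ((i, a, j), (k, b, l))" "(i, a, j) \<in> \<eta>" "(k, b, l) \<in> \<nu>"
      "i \<le> k" "l \<le> j"
      by (auto simp: nested_pairs_def)
    note bounds = \<eta>D(1-4)[OF v(2)] \<nu>D(1-4)[OF v(3)]
    \<comment> \<open>Reflection reverses the order at both ends, so the dual arcs are nested in the
      same way.\<close>
    show "?\<sigma> v \<in> ?V"
      using \<eta>'(2)[OF v(2)] \<nu>'(2)[OF v(3)] v bounds
      by (auto simp: nested_pairs_def arc_dual_def bar_le_iff)
    show "?\<sigma> (?\<sigma> v) = v"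
      using v bounds by (simp add: arc_dual_def uminus_power_q)
    show "pair_coeff v \<noteq> 0"
      using v bounds by (simp add: pair_coeff_def)
    \<comment> \<open>The two minus signs of the dual labels cancel.\<close>
    show "pair_coeff (?\<sigma> v) = pair_coeff v ^ q"
      using v by (simp add: pair_coeff_def arc_dual_def power_mult_distrib)
  qed
  have form: "lambda_of n q \<eta> (act n q (UT_of n r) (x_of n \<nu>)) = form ?V ?D r"
    if "UT_of n r \<in> carrier (UT n)" for r
    unfolding lambda_of_act[OF \<eta>'(1) \<nu> that] form_def
  proof (rule sum.cong[OF refl])
    fix v assume "v \<in> ?V"
    then obtain i a j k b l where v: "v = ((i, a, j), (k, b, l))" "(i, a, j) \<in> \<eta>" "(k, b, l) \<in> \<nu>"
      "i \<le> k" "l \<le> j"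
      by (auto simp: nested_pairs_def)
    have "i < n" "k < n" "bar n j < n" "bar n l < n" "bar n j \<le> bar n l"
      using v \<eta>D(1-4)[OF v(2)] \<nu>D(1-4)[OF v(3)] by (auto simp: bar_le_iff)
    then show "(\<lambda>((i, a, j), (k, b, l)).
          a * b * UT_of n r $$ (i, k) * UT_of n r $$ (bar n j, bar n l) ^ q) v
        = pair_coeff v * entry ?D r (pair_pos v) * entry ?D r (pair_pos (?\<sigma> v)) ^ q"
      using v by (simp add: pair_coeff_def pair_pos_def arc_dual_def entry_def UT_of_def strict_pairs_def)
  qed
  have sum: "(\<Sum>g\<in>carrier (UT n). \<theta> (lambda_of n q \<eta> (act n q g (x_of n \<nu>))))
      = (\<Sum>r\<in>PiE ?D (\<lambda>_. UNIV). \<theta> (form ?V ?D r))"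
  proof -
    have "(\<Sum>g\<in>carrier (UT n). \<theta> (lambda_of n q \<eta> (act n q g (x_of n \<nu>))))
        = (\<Sum>r\<in>PiE ?D (\<lambda>_. UNIV). \<theta> (lambda_of n q \<eta> (act n q (UT_of n r) (x_of n \<nu>))))"
      by (rule sum.reindex_bij_betw[OF bij_betw_UT_of, symmetric])
    also have "\<dots> = (\<Sum>r\<in>PiE ?D (\<lambda>_. UNIV). \<theta> (form ?V ?D r))"
      by (intro sum.cong refl) (simp add: form bij_betw_apply[OF bij_betw_UT_of])
    finally show ?thesis .
  qed
  \<comment> \<open>For a nested pair, leaving \<open>?D\<close> means lying on the diagonal: a
    common left endpoint for the pair itself, a common right endpoint for its dual.\<close>
  have pos: "pair_pos ((i, a, j), (k, b, l)) \<notin> ?D \<longleftrightarrow> i = k"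
    "pair_pos (?\<sigma> ((i, a, j), (k, b, l))) \<notin> ?D \<longleftrightarrow> j = l"
    if "((i, a, j), (k, b, l)) \<in> ?V" for i a j k b l
    using that \<eta>D(1-4)[of i a j] \<nu>D(1-4)[of k b l]
    by (auto simp: nested_pairs_def pair_pos_def strict_pairs_def arc_dual_def bar_less_iff)
  show ?thesis
  proof (cases "\<forall>i j k. arc \<eta> i j \<and> i < k \<and> k < j \<longrightarrow> \<not> arc \<nu> i k \<and> \<not> arc \<nu> k j")
    case cond: True
    \<comment> \<open>A nested pair with \<open>i = k\<close> and \<open>l < j\<close> violates the
      condition with middle index \<open>l\<close>; one with \<open>j = l\<close> and
      \<open>i < k\<close> violates it with middle index \<open>k\<close>.\<close>
    have ends: "i = k \<longleftrightarrow> j = l" if "((i, a, j), (k, b, l)) \<in> ?V" for i a j k b l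
    proof -
      have "arc \<eta> i j" "arc \<nu> k l" "i \<le> k" "l \<le> j" "k < l"
        using that \<nu>D(1)[of k b l] by (auto simp: nested_pairs_def arc_def)
      then show ?thesis
        using cond[rule_format, of i j k] cond[rule_format, of i j l] by (auto simp: le_less)
    qed
    have closed: "pair_pos v \<in> ?D \<longleftrightarrow> pair_pos (?\<sigma> v) \<in> ?D" if "v \<in> ?V" for v
    proof -
      obtain i a j k b l where v: "v = ((i, a, j), (k, b, l))"
        by (metis prod.exhaust)
      show ?thesis
        using pos[of i a j k b l] ends[of i a j k b l] that unfolding v by blast
    qed
    \<comment> \<open>With no single shared endpoint, an off-diagonal position means strict nesting
      at both ends, and the four endpoints recover the pair.\<close>
    have nst: "card {v \<in> ?V. pair_pos v \<in> ?D} = nst \<eta> \<nu>"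
      unfolding nst_def
    proof (rule bij_betw_same_card[of "\<lambda>((i, a, j), (k, b, l)). (i, k, l, j)"], rule bij_betw_imageI)
      show "inj_on (\<lambda>((i, a, j), (k, b, l)). (i, k, l, j)) {v \<in> ?V. pair_pos v \<in> ?D}"
        by (rule inj_onI, rule nested_pairs_eqI[OF \<eta>'(1) \<nu>'(1)]) (auto simp: case_prod_unfold)
      show "(\<lambda>((i, a, j), (k, b, l)). (i, k, l, j)) ` {v \<in> ?V. pair_pos v \<in> ?D}
          = {(i, j, k, l). i < j \<and> j < k \<and> k < l \<and> arc \<nu> j k \<and> arc \<eta> i l}" (is "?L = ?R")
      proof (intro equalityI subsetI)
        fix t assume "t \<in> ?L"
        then obtain i a j k b l where v: "t = (i, k, l, j)" "((i, a, j), (k, b, l)) \<in> ?V"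
          "pair_pos ((i, a, j), (k, b, l)) \<in> ?D"
          by auto
        then have "i \<noteq> k" "j \<noteq> l"
          using pos ends by blast+
        then show "t \<in> ?R"
          using v \<nu>D(1) by (auto simp: nested_pairs_def arc_def le_less)
      next
        fix t assume "t \<in> ?R"
        then obtain i a j k b l where t: "t = (i, k, l, j)" "(i, a, j) \<in> \<eta>" "(k, b, l) \<in> \<nu>" "i < k" "l < j"
          by (auto simp: arc_def)
        then have "((i, a, j), (k, b, l)) \<in> ?V" "pair_pos ((i, a, j), (k, b, l)) \<in> ?D"
          using \<nu>D(1-4)[OF t(3)] by (auto simp: nested_pairs_def pair_pos_def strict_pairs_def)
        then show "t \<in> ?L"
          using t by (force simp: image_iff)
      qed
    qed
    have fixed: "(\<Sum>v | v \<in> ?V \<and> pair_pos v \<notin> ?D. pair_coeff v)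
        = (\<Sum>(i, a, b, j)\<in>{(i, a, b, j). (i, a, j) \<in> \<eta> \<and> (i, b, j) \<in> \<nu>}. a * b)"
    proof (rule sum.reindex_bij_witness[of _ "\<lambda>(i, a, b, j). ((i, a, j), (i, b, j))"
          "\<lambda>((i, a, j), (k, b, l)). (i, a, b, j)"])
      fix v assume "v \<in> {v \<in> ?V. pair_pos v \<notin> ?D}"
      then obtain i a j k b l where v: "v = ((i, a, j), (k, b, l))" "v \<in> ?V" "pair_pos v \<notin> ?D"
        by (metis (no_types, lifting) mem_Collect_eq prod.exhaust)
      then have [simp]: "k = i" "l = j"
        using pos ends by blast+
      show "(\<lambda>(i, a, b, j). ((i, a, j), (i, b, j))) ((\<lambda>((i, a, j), (k, b, l)). (i, a, b, j)) v) = v"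
        "(\<lambda>((i, a, j), (k, b, l)). (i, a, b, j)) v \<in> {(i, a, b, j). (i, a, j) \<in> \<eta> \<and> (i, b, j) \<in> \<nu>}"
        "(case (\<lambda>((i, a, j), (k, b, l)). (i, a, b, j)) v of (i, a, b, j) \<Rightarrow> a * b) = pair_coeff v"
        using v(2) unfolding v(1) by (auto simp: nested_pairs_def pair_coeff_def)
    qed (auto simp: nested_pairs_def pair_pos_def strict_pairs_def)
    have "of_nat (card (carrier (UT n :: 'a mat monoid))) = (of_nat q ^ (2 * card ?D) :: complex)"
      by (simp add: card_UT card_UNIV_eq power_mult)
    then show ?thesis
      using sum_theta_form[OF V finite_strict_pairs closed] unfolding sum nst fixed if_P[OF cond] by simp
  next
    case False
    then obtain i j k where ijk: "arc \<eta> i j" "i < k" "k < j" "arc \<nu> i k \<or> arc \<nu> k j"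
      by blast
    then obtain a b where ab: "(i, a, j) \<in> \<eta>" "(i, b, k) \<in> \<nu> \<or> (k, b, j) \<in> \<nu>"
      by (auto simp: arc_def)
    have "\<exists>v\<in>?V. pair_pos v \<notin> ?D \<and> pair_pos (?\<sigma> v) \<in> ?D"
    proof (cases "(i, b, k) \<in> \<nu>")
      case True
      then have "((i, a, j), (i, b, k)) \<in> ?V"
        using ab ijk by (simp add: nested_pairs_def)
      then show ?thesis
        using pos ijk by blast
    next
      case False
      \<comment> \<open>With a shared right endpoint the roles are exchanged, so the dual of this
        pair is the witness.\<close>
      let ?v = "((i, a, j), (k, b, j))"
      have v: "?v \<in> ?V"
        using False ab ijk by (simp add: nested_pairs_def)
      then have "pair_pos ?v \<in> ?D" "pair_pos (?\<sigma> ?v) \<notin> ?D"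
        using pos ijk by blast+
      then show ?thesis
        using admissibleD(3,4)[OF V v] by metis
    qed
    then show ?thesis
      using sum_theta_form_eq_0[OF V] False unfolding sum by (simp only: if_False) blast
  qed
qed

end

section \<open>The characteristic of the field and the evaluation of the character\<close>

lemma CHAR_eqI:
  assumes "prime p" "card (UNIV :: 'a::{field, finite} set) = p ^ m"
  shows "CHAR('a) = p"
proof -
  have "prime CHAR('a)"
    by (intro prime_CHAR_semidom finite_imp_CHAR_pos) simp
  moreover have "CHAR('a) dvd p ^ m"
    using CHAR_dvd_CARD[where ?'a = 'a] assms by simp
  ultimately show ?thesis
    using assms(1) prime_dvd_power primes_dvd_imp_eq by blast
qed

theorem theorem7p9:
  fixes p e q n :: nat
    and f :: "'a::{field, finite} mat \<Rightarrow> 'a mat"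
    and \<theta> :: "'a \<Rightarrow> complex"
    and \<eta> \<nu> :: "(nat \<times> 'a \<times> nat) set"
  assumes "prime p" and "odd p" and "e \<ge> 1" and "q = p ^ e"
    and "card (UNIV :: 'a set) = q ^ 2"
    and "springer n q f"
    and "nontrivial_char q \<theta>"
    and "twisted_set_partition n q \<eta>"
    and "twisted_set_partition n q \<nu>"
  shows "chi_part n q f \<theta> \<eta> (u_of n q f \<nu>) =
    (if \<forall>i j k. arc \<eta> i j \<and> i < k \<and> k < j \<longrightarrow> \<not> arc \<nu> i k \<and> \<not> arc \<nu> k j
     then chi_part n q f \<theta> \<eta> (1\<^sub>m n) / (- of_nat q) ^ nst \<eta> \<nu> *
          \<theta> (\<Sum>(i, a, b, j) \<in> {(i, a, b, j). (i, a, j) \<in> \<eta> \<and> (i, b, j) \<in> \<nu>}. a * b)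
     else 0)"
proof -
  \<comment> \<open>The field has \<open>p ^ (2 * e)\<close> elements; knowing its characteristic
    gives additivity of the \<open>q\<close>-th power.\<close>
  have char: "CHAR('a) = p"
    using assms(1,4,5) by (intro CHAR_eqI[of p "e * 2"]) (auto simp: power_mult)
  interpret quadratic_char q \<theta>
  proof
    show "1 < q"
      unfolding assms(4) using assms(1,3) prime_gt_1_nat[of p] by (intro one_less_power) auto
    show "(x + y) ^ q = x ^ q + y ^ q" for x y :: 'a
      unfolding assms(4) using assms(1) char by (intro freshmans_dream') auto
  qed fact+
  let ?l = "lambda_of n q \<eta>" and ?O = "orbit (HH n) (coact n q) (lambda_of n q \<eta>)"
  have ext: "?l \<in> extensional (uu n q)"
    by (simp add: lambda_of_def)
  have f: "inj_on f (UU n q)" "f ` UU n q = uu n q"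
    using assms(6) by (auto simp: springer_def bij_betw_def UU_def intro: inj_on_subset)
  have f_u: "f (u_of n q f \<nu>) = x_of n \<nu>"
    unfolding u_of_def using f x_of_uu[OF assms(9)] by (simp add: f_the_inv_into_f)
  have zero: "(0\<^sub>m n n :: 'a mat) \<in> uu n q"
  proof -
    \<comment> \<open>The empty set is a twisted set partition, so membership of zero is an instance
      of the general result.\<close>
    have "0\<^sub>m n n = (x_of n {} :: 'a mat)"
      by (intro eq_matI) (auto simp: x_of_def arc_def)
    then show ?thesis
      using x_of_uu[of n "{}"] by (simp add: twisted_set_partition_def set_partition_def)
  qed
  \<comment> \<open>The exponents start at 2; at exponent 0 the power would be the identity.\<close>
  have pow: "(0\<^sub>m n n ^\<^sub>m k) = (0\<^sub>m n n :: 'a mat)" if "k \<in> {2..n}" for k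
    using that by (cases k) (auto intro!: right_mult_zero_mat pow_carrier_mat)
  have f_1: "f (1\<^sub>m n) = 0\<^sub>m n n"
  proof -
    have "f (1\<^sub>m n + 0\<^sub>m n n) = 0\<^sub>m n n"
      using assms(6) zero unfolding springer_def uu_def
      by (auto simp: pow intro!: eq_matI)
    then show ?thesis
      by simp
  qed
  \<comment> \<open>Since \<open>f\<close> sends the identity to zero, every term of the average is
    \<open>\<theta> 0 = 1\<close>, so the degree is the size of the orbit under
    \<open>HH n\<close>.\<close>
  have "chi_part n q f \<theta> \<eta> (1\<^sub>m n) = of_nat (card ?O)"
  proof -
    have "?l (act n q g (0\<^sub>m n n)) = 0" if "g \<in> carrier (UT n)" for g
    proof -
      have "act n q g (0\<^sub>m n n) = 0\<^sub>m n n"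
        using UT_carrier_mat[OF that] by (simp add: act_def)
      then show ?thesis
        using zero set_partitionD[OF twisted_set_partitionD(1)[OF assms(8)]]
        by (auto simp: lambda_of_def intro!: sum.neutral)
    qed
    then have "(\<Sum>g\<in>carrier (UT n). \<theta> (?l (act n q g (f (1\<^sub>m n)))))
        = of_nat (card (carrier (UT n :: 'a mat monoid)))"
      by (simp add: f_1)
    moreover have "card (carrier (UT n :: 'a mat monoid)) \<noteq> 0"
      using q_gt_1 by (simp add: card_UT card_UNIV_eq)
    ultimately show ?thesis
      unfolding chi_part_def using chi_average[OF ext, of f "1\<^sub>m n"] zero by (simp add: f_1)
  qed
  moreover have "chi_part n q f \<theta> \<eta> (u_of n q f \<nu>) = of_nat (card ?O) *
     (\<Sum>g\<in>carrier (UT n). \<theta> (?l (act n q g (x_of n \<nu>)))) / of_nat (card (carrier (UT n :: 'a mat monoid)))"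
    unfolding chi_part_def using chi_average[OF ext, of f "u_of n q f \<nu>"] x_of_uu[OF assms(9)]
    by (simp add: f_u)
  moreover have "card (carrier (UT n :: 'a mat monoid)) \<noteq> 0"
    using q_gt_1 by (simp add: card_UT card_UNIV_eq)
  moreover define C where
    "C \<longleftrightarrow> (\<forall>i j k. arc \<eta> i j \<and> i < k \<and> k < j \<longrightarrow> \<not> arc \<nu> i k \<and> \<not> arc \<nu> k j)"
  ultimately show ?thesis
    unfolding sum_theta_lambda_of[OF assms(8,9)] C_def[symmetric] by simp
qed

end
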